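(* Let $G$ be a cyclically 6-edge-connected cubic graph. If $\mu_2(G) \leq 2$, then $G$ has a nowhere-zero 5-flow.
   Context: A cubic graph is a graph all of whose vertices have degree 3 (graphs are finite). A graph is cyclically $k$-edge-connected if it has no edge cut $E$ with fewer than $k$ edges such that two components of $G-E$ contain circuits. A 1-factor of $G$ is a perfect matching, regarded as a set of edges. For a bridgeless cubic graph $G$, $\mu_2(G) = \min\{|M_1 \cap M_2| : M_1 \text{ and } M_2 \text{ are 1-factors of } G\}$ (1-factors exist by Petersen's theorem). A nowhere-zero $k$-flow on $G$ is an assignment of a direction and a value from $\{1,\dots,k-1\}$ to each edge of $G$ such that Kirchhoff's law holds at every vertex (the sum of the values on incoming edges equals the sum of the values on outgoing edges). *)

theory Defs
  imports Main "HOL-Library.Extended_Nat"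
begin

text \<open>
  Finite undirected graphs. Parallel edges and loops are allowed: an edge \<open>e\<close> joins the
  vertices in \<open>ends G e\<close>, a set with two elements for an ordinary edge and one element for a loop.
\<close>

record ('v, 'e) mgraph =
  verts :: "'v set"
  edges :: "'e set"
  ends :: "'e \<Rightarrow> 'v set"

definition multigraph :: "('v, 'e) mgraph \<Rightarrow> bool" where
  "multigraph G \<longleftrightarrow> finite (verts G) \<and> finite (edges G) \<and>
     (\<forall>e\<in>edges G. \<exists>u\<in>verts G. \<exists>v\<in>verts G. ends G e = {u, v})"

text \<open>The degree of \<open>v\<close> in the spanning subgraph with edge set \<open>F\<close>; a loop counts twice.\<close>

definition degree_in :: "('v, 'e) mgraph \<Rightarrow> 'e set \<Rightarrow> 'v \<Rightarrow> nat" where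
  "degree_in G F v = card {e \<in> F. v \<in> ends G e} + card {e \<in> F. ends G e = {v}}"

definition cubic :: "('v, 'e) mgraph \<Rightarrow> bool" where
  "cubic G \<longleftrightarrow> (\<forall>v\<in>verts G. degree_in G (edges G) v = 3)"

definition one_factor :: "('v, 'e) mgraph \<Rightarrow> 'e set \<Rightarrow> bool" where
  "one_factor G M \<longleftrightarrow> M \<subseteq> edges G \<and> (\<forall>v\<in>verts G. degree_in G M v = 1)"

text \<open>
  The minimum is taken in \<^typ>\<open>enat\<close>, so that a graph without 1-factors gets the value \<open>\<infinity>\<close>
  rather than an arbitrary natural number. As soon as a 1-factor exists, this is the minimum of
  a nonempty set of natural numbers.
\<close>

definition mu2 :: "('v, 'e) mgraph \<Rightarrow> enat" where
  "mu2 G = Inf {enat (card (M1 \<inter> M2)) | M1 M2. one_factor G M1 \<and> one_factor G M2}"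

definition delete_edges :: "('v, 'e) mgraph \<Rightarrow> 'e set \<Rightarrow> ('v, 'e) mgraph" where
  "delete_edges G F = G\<lparr>edges := edges G - F\<rparr>"

definition adjacency :: "('v, 'e) mgraph \<Rightarrow> ('v \<times> 'v) set" where
  "adjacency G = {(u, v). \<exists>e\<in>edges G. ends G e = {u, v}}"

text \<open>Components are represented by their vertex sets.\<close>

definition components :: "('v, 'e) mgraph \<Rightarrow> 'v set set" where
  "components G = verts G // {(u, v). u \<in> verts G \<and> v \<in> verts G \<and> (u, v) \<in> (adjacency G)\<^sup>*}"

text \<open>
  A circuit is given by its cyclic sequences of distinct vertices and distinct edges, the \<open>i\<close>-th
  edge joining the \<open>i\<close>-th vertex to its cyclic successor. Length 1 is a loop, and length 2 is a
  pair of parallel edges.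
\<close>

definition circuit :: "('v, 'e) mgraph \<Rightarrow> 'v list \<Rightarrow> 'e list \<Rightarrow> bool" where
  "circuit G vs es \<longleftrightarrow>
     vs \<noteq> [] \<and> length es = length vs \<and> distinct vs \<and> distinct es \<and>
     set vs \<subseteq> verts G \<and> set es \<subseteq> edges G \<and>
     (\<forall>i<length vs. ends G (es ! i) = {vs ! i, vs ! (Suc i mod length vs)})"

definition contains_circuit :: "('v, 'e) mgraph \<Rightarrow> 'v set \<Rightarrow> bool" where
  "contains_circuit G C \<longleftrightarrow> (\<exists>vs es. circuit G vs es \<and> set vs \<subseteq> C)"

text \<open>
  An edge cut consists of all edges between a nonempty proper subset of the vertices and its
  complement. In a disconnected graph the empty set is an edge cut.
\<close>

definition edge_cut :: "('v, 'e) mgraph \<Rightarrow> 'e set \<Rightarrow> bool" where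
  "edge_cut G F \<longleftrightarrow> (\<exists>X. X \<noteq> {} \<and> X \<subset> verts G \<and>
     F = {e \<in> edges G. ends G e \<inter> X \<noteq> {} \<and> ends G e - X \<noteq> {}})"

definition cyclically_edge_connected :: "nat \<Rightarrow> ('v, 'e) mgraph \<Rightarrow> bool" where
  "cyclically_edge_connected k G \<longleftrightarrow>
     \<not> (\<exists>F. edge_cut G F \<and> card F < k \<and>
          (\<exists>C\<in>components (delete_edges G F). \<exists>D\<in>components (delete_edges G F).
             C \<noteq> D \<and> contains_circuit (delete_edges G F) C \<and>
             contains_circuit (delete_edges G F) D))"

text \<open>Each edge \<open>e\<close> is directed from \<open>tail e\<close> to \<open>head e\<close>.\<close>

definition orientation :: "('v, 'e) mgraph \<Rightarrow> ('e \<Rightarrow> 'v) \<Rightarrow> ('e \<Rightarrow> 'v) \<Rightarrow> bool" where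
  "orientation G tail head \<longleftrightarrow> (\<forall>e\<in>edges G. ends G e = {tail e, head e})"

definition has_nowhere_zero_flow :: "nat \<Rightarrow> ('v, 'e) mgraph \<Rightarrow> bool" where
  "has_nowhere_zero_flow k G \<longleftrightarrow>
     (\<exists>tail head (f :: 'e \<Rightarrow> nat). orientation G tail head \<and>
        (\<forall>e\<in>edges G. f e \<in> {1..k - 1}) \<and>
        (\<forall>v\<in>verts G. (\<Sum>e | e \<in> edges G \<and> head e = v. f e) =
                      (\<Sum>e | e \<in> edges G \<and> tail e = v. f e)))"

end

(* A cubic graph has a nowhere-zero 5-flow as soon as some sign function s on the vertices satisfies
   5 |s(X)| <= 3 |boundary of X| for all vertex sets X (Jaeger; via Hoffman's circulation theorem).
   Let M1, M2 be 1-factors with at most two common edges, and let s be a proper 2-colouring of the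
   bipartite graph M1 Un M2 with colours 1 and -1. Both 1-factors cross the boundary of X at least
   |s(X)| times, and by cyclic connectivity a boundary with fewer than 6 edges is as large as a tree
   allows. So s can only fail on a 6-edge cut that contains both common edges and no edge outside
   M1 Un M2, with s(X) = 4 after complementation and with s = 1 on the ends of the common edges in X.

   Interchanging the colours at the ends of a common edge gives another proper 2-colouring. If s and
   its modifications at one and at both common edges all fail, uncrossing the three cuts shows that
   the corners have exactly 3 vertices and are determined by the ends of common edges that they
   contain. Hence the first and third cuts have the same boundary, and this contradicts the values
   of the two colourings on them. *)

theory Submission
  imports Defs
begin

subsection \<open>Integral flows with prescribed net outflow\<close>

text \<open>The least net outflow of \<open>S\<close> under capacities \<open>l \<le> u\<close>; for \<open>l = u = f\<close> it is the net
  outflow of \<open>f\<close>.\<close>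

definition demand_bound ::
  "'e set \<Rightarrow> ('e \<Rightarrow> 'v) \<Rightarrow> ('e \<Rightarrow> 'v) \<Rightarrow> ('e \<Rightarrow> int) \<Rightarrow> ('e \<Rightarrow> int) \<Rightarrow> 'v set \<Rightarrow> int" where
  "demand_bound E t h l u S =
     (\<Sum>e\<in>E. if t e \<in> S \<and> h e \<notin> S then l e else if t e \<notin> S \<and> h e \<in> S then - u e else 0)"

definition net_out :: "'e set \<Rightarrow> ('e \<Rightarrow> 'v) \<Rightarrow> ('e \<Rightarrow> 'v) \<Rightarrow> ('e \<Rightarrow> int) \<Rightarrow> 'v \<Rightarrow> int" where
  "net_out E t h f v = (\<Sum>e | e \<in> E \<and> t e = v. f e) - (\<Sum>e | e \<in> E \<and> h e = v. f e)"

text \<open>An edge with both ends in \<open>S\<close> occurs once with each sign and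
  cancels.\<close>

lemma sum_net_out:
  assumes "finite E" "finite S"
  shows "(\<Sum>v\<in>S. net_out E t h f v) = demand_bound E t h f f S"
proof -
  have 1: "(\<Sum>v\<in>S. \<Sum>e | e \<in> E \<and> g e = v. f e) = (\<Sum>e\<in>E. if g e \<in> S then f e else 0)" for g :: "'a \<Rightarrow> 'b"
  proof -
    have "(\<Sum>v\<in>S. \<Sum>e | e \<in> E \<and> g e = v. f e) = (\<Sum>v\<in>S. \<Sum>e\<in>E. if g e = v then f e else 0)"
      using assms by (intro sum.cong refl sum.mono_neutral_cong_left) auto
    also have "\<dots> = (\<Sum>e\<in>E. \<Sum>v\<in>S. if g e = v then f e else 0)" by (rule sum.swap)
    also have "\<dots> = (\<Sum>e\<in>E. if g e \<in> S then f e else 0)"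
      using assms by (intro sum.cong refl) simp
    finally show ?thesis .
  qed
  show ?thesis
    unfolding net_out_def demand_bound_def sum_subtractf 1
    unfolding sum_subtractf[symmetric] by (intro sum.cong refl) auto
qed

text \<open>Supermodularity, checked edge by edge. The edge \<open>a\<close> contributes
  \<open>l a - u a\<close> to the two terms on the left and nothing to \<open>S \<inter> T\<close>
  or \<open>S \<union> T\<close>, which leaves exactly the surplus \<open>u a - l a\<close>.\<close>

lemma demand_bound_uncross:
  assumes E: "finite E" "a \<in> E" and le: "\<And>e. e \<in> E \<Longrightarrow> l e \<le> u e"
    and a: "t a \<in> S - T" "h a \<in> T - S"
  shows "demand_bound E t h l u S + demand_bound E t h l u T + (u a - l a)
    \<le> demand_bound E t h l u (S \<inter> T) + demand_bound E t h l u (S \<union> T)"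
proof -
  have d: "u a - l a = (\<Sum>e\<in>E. if e = a then u a - l a else 0)" using E by simp
  show ?thesis
    unfolding demand_bound_def
    apply (subst d)
    apply (unfold sum.distrib[symmetric])
    apply (rule sum_mono)
    subgoal for e using le[of e] a by (cases "e = a") auto
    done
qed

text \<open>Hoffman's circulation theorem, by narrowing the capacity intervals: if an edge \<open>a\<close> admits
  neither raising its lower nor lowering its upper bound, then two tight sets cross along \<open>a\<close>,
  which contradicts supermodularity.\<close>

theorem feasible_integer_flow:
  fixes l u :: "'e \<Rightarrow> int"
  assumes fin: "finite E" "finite V" and tV: "\<And>e. e \<in> E \<Longrightarrow> t e \<in> V" and hV: "\<And>e. e \<in> E \<Longrightarrow> h e \<in> V"
    and le: "\<And>e. e \<in> E \<Longrightarrow> l e \<le> u e"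
    and b0: "sum b V = 0"
    and bound: "\<And>S. S \<subseteq> V \<Longrightarrow> demand_bound E t h l u S \<le> sum b S"
  shows "\<exists>f. (\<forall>e\<in>E. l e \<le> f e \<and> f e \<le> u e) \<and> (\<forall>v\<in>V. net_out E t h f v = b v)"
  using le bound
proof (induction "nat (\<Sum>e\<in>E. u e - l e)" arbitrary: l u rule: less_induct)
  case less
  note le = less.prems(1) and bound = less.prems(2)
  show ?case
  proof (cases "\<forall>e\<in>E. l e = u e")
    case True
    have eq: "demand_bound E t h l u S = demand_bound E t h l l S" for S
      unfolding demand_bound_def using True by (intro sum.cong) auto
    have "net_out E t h l v = b v" if v: "v \<in> V" for v
    proof -
      have n: "net_out E t h l v = demand_bound E t h l l {v}"
        using sum_net_out[OF fin(1), of "{v}" t h l] by simp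
      \<comment> \<open>The bound for the complement of \<open>v\<close> yields the reverse
        inequality, because the net outflow and \<open>b\<close> both have total 0.\<close>
      have "demand_bound E t h l l (V - {v}) = - demand_bound E t h l l {v}"
        unfolding demand_bound_def sum_negf[symmetric] using tV hV by (intro sum.cong refl) auto
      moreover have "sum b (V - {v}) = - b v" using b0 fin v by (simp add: sum_diff1)
      ultimately show ?thesis using bound[of "{v}"] bound[of "V - {v}"] v n by (simp add: eq)
    qed
    then show ?thesis using le by (intro exI[of _ l]) auto
  next
    case False
    then obtain a where a: "a \<in> E" "l a < u a" using le by force
    show ?thesis
    proof (cases "\<forall>S\<subseteq>V. demand_bound E t h (l(a := l a + 1)) u S \<le> sum b S")
      case True
      let ?l = "l(a := l a + 1)"
      have "(\<Sum>e\<in>E. u e - ?l e) < (\<Sum>e\<in>E. u e - l e)"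
        using a fin(1) by (intro sum_strict_mono_ex1) auto
      then have lt: "nat (\<Sum>e\<in>E. u e - ?l e) < nat (\<Sum>e\<in>E. u e - l e)" if "0 \<le> (\<Sum>e\<in>E. u e - ?l e)"
        using that by linarith
      have le': "?l e \<le> u e" if "e \<in> E" for e using le[OF that] a by auto
      then have nn: "0 \<le> (\<Sum>e\<in>E. u e - ?l e)" by (intro sum_nonneg) simp
      then have "\<exists>f. (\<forall>e\<in>E. ?l e \<le> f e \<and> f e \<le> u e) \<and> (\<forall>v\<in>V. net_out E t h f v = b v)"
        using True by (intro less.hyps[OF lt[OF nn] le']) (simp_all del: fun_upd_apply)
      then obtain f where f: "\<forall>e\<in>E. ?l e \<le> f e \<and> f e \<le> u e" "\<forall>v\<in>V. net_out E t h f v = b v"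
        by blast
      have "l e \<le> f e" if "e \<in> E" for e
        using bspec[OF f(1) that] by (cases "e = a") auto
      then show ?thesis using f by blast
    next
      case noS: False
      show ?thesis
      proof (cases "\<forall>S\<subseteq>V. demand_bound E t h l (u(a := u a - 1)) S \<le> sum b S")
        case True
        let ?u = "u(a := u a - 1)"
        have "(\<Sum>e\<in>E. ?u e - l e) < (\<Sum>e\<in>E. u e - l e)"
          using a fin(1) by (intro sum_strict_mono_ex1) auto
        then have lt: "nat (\<Sum>e\<in>E. ?u e - l e) < nat (\<Sum>e\<in>E. u e - l e)" if "0 \<le> (\<Sum>e\<in>E. ?u e - l e)"
          using that by linarith
        have le': "l e \<le> ?u e" if "e \<in> E" for e using le[OF that] a by auto
        then have nn: "0 \<le> (\<Sum>e\<in>E. ?u e - l e)" by (intro sum_nonneg) simp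
        then have "\<exists>f. (\<forall>e\<in>E. l e \<le> f e \<and> f e \<le> ?u e) \<and> (\<forall>v\<in>V. net_out E t h f v = b v)"
          using True by (intro less.hyps[OF lt[OF nn] le']) (simp_all del: fun_upd_apply)
        then obtain f where f: "\<forall>e\<in>E. l e \<le> f e \<and> f e \<le> ?u e" "\<forall>v\<in>V. net_out E t h f v = b v"
          by blast
        have "f e \<le> u e" if "e \<in> E" for e
          using bspec[OF f(1) that] by (cases "e = a") auto
        then show ?thesis using f by blast
      next
        case noT: False
        obtain S where S: "S \<subseteq> V" "demand_bound E t h (l(a := l a + 1)) u S > sum b S"
          using noS unfolding not_all not_imp not_le by blast
        obtain T where T: "T \<subseteq> V" "demand_bound E t h l (u(a := u a - 1)) T > sum b T"
          using noT unfolding not_all not_imp not_le by blast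
        have delta: "c = (\<Sum>e\<in>E. if e = a then c else 0)" for c :: int using a fin by simp
        have dS: "demand_bound E t h (l(a := l a + 1)) u S
          = demand_bound E t h l u S + (if t a \<in> S \<and> h a \<notin> S then 1 else 0)"
          by (subst delta[of "if t a \<in> S \<and> h a \<notin> S then 1 else 0"])
            (unfold demand_bound_def sum.distrib[symmetric], intro sum.cong, auto)
        have dT: "demand_bound E t h l (u(a := u a - 1)) T
          = demand_bound E t h l u T + (if t a \<notin> T \<and> h a \<in> T then 1 else 0)"
          by (subst delta[of "if t a \<notin> T \<and> h a \<in> T then 1 else 0"])
            (unfold demand_bound_def sum.distrib[symmetric], intro sum.cong, auto)
        \<comment> \<open>Before the narrowing both sets satisfy their bounds, so each violation
          comes from the changed capacity: \<open>a\<close> leaves \<open>S\<close> and enters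
          \<open>T\<close>.\<close>
        have inS: "t a \<in> S \<and> h a \<notin> S"
          using dS bound[OF S(1)] S(2) by (simp del: fun_upd_apply split: if_splits)
        have inT: "t a \<notin> T \<and> h a \<in> T"
          using dT bound[OF T(1)] T(2) by (simp del: fun_upd_apply split: if_splits)
        have cross: "t a \<in> S - T" "h a \<in> T - S" using inS inT by auto
        \<comment> \<open>By integrality \<open>S\<close> and \<open>T\<close> are tight for the old
          capacities, so uncrossing leaves no room for the positive width
          \<open>u a - l a\<close>.\<close>
        have "demand_bound E t h l u S + demand_bound E t h l u T + (u a - l a)
          \<le> sum b (S \<inter> T) + sum b (S \<union> T)"
          using demand_bound_uncross[where l = l and u = u and t = t and h = h and S = S and T = T, OF fin(1) a(1) le cross]
            bound[OF le_infI1[OF S(1), of T]] bound[OF Un_least[OF S(1) T(1)]] by linarith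
        also have "\<dots> = sum b S + sum b T"
          using sum.union_inter[of S T b] fin S T by (simp add: finite_subset)
        finally show ?thesis
          using dS dT S(2) T(2) a(2) inS inT by (simp del: fun_upd_apply)
      qed
    qed
  qed
qed

subsection \<open>Balanced valuations\<close>

text \<open>The edge set is a parameter because a cut is counted separately in each 1-factor, in
  their intersection and in the remaining edges.\<close>

definition boundary :: "('v, 'e) mgraph \<Rightarrow> 'e set \<Rightarrow> 'v set \<Rightarrow> 'e set" where
  "boundary G F X = {e \<in> F. ends G e \<inter> X \<noteq> {} \<and> ends G e - X \<noteq> {}}"

lemma multigraph_endsE:
  assumes "multigraph G" "e \<in> edges G"
  obtains u v where "u \<in> verts G" "v \<in> verts G" "ends G e = {u, v}"
  using assms unfolding multigraph_def by blast

lemma multigraph_finite: "multigraph G \<Longrightarrow> finite (verts G)" "multigraph G \<Longrightarrow> finite (edges G)"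
  by (auto simp: multigraph_def)

lemma multigraph_ends:
  assumes "multigraph G" "e \<in> edges G"
  shows "ends G e \<subseteq> verts G" "ends G e \<noteq> {}"
  by (rule multigraph_endsE[OF assms]; auto)+

text \<open>Double counting of incidences; a loop inside \<open>X\<close> reaches its contribution 2
  through the second summand of \<open>degree_in\<close>.\<close>

lemma sum_degree_in:
  assumes G: "multigraph G" and F: "F \<subseteq> edges G" and X: "X \<subseteq> verts G"
  shows "(\<Sum>v\<in>X. degree_in G F v) = 2 * card {e \<in> F. ends G e \<subseteq> X} + card (boundary G F X)"
proof -
  have fin: "finite F" "finite X" using multigraph_finite[OF G] F X finite_subset by auto
  have c: "card {e \<in> F. P e} = (\<Sum>e\<in>F. if P e then 1 else 0)" for P
    using fin by (simp only: card_eq_sum sum.inter_filter)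
  have "(\<Sum>v\<in>X. degree_in G F v)
      = (\<Sum>v\<in>X. \<Sum>e\<in>F. (if v \<in> ends G e then 1 else 0) + (if ends G e = {v} then 1 else 0))"
    unfolding degree_in_def c by (simp only: sum.distrib)
  also have "\<dots> = (\<Sum>e\<in>F. \<Sum>v\<in>X. (if v \<in> ends G e then 1 else 0) + (if ends G e = {v} then 1 else 0))"
    by (rule sum.swap)
  also have "\<dots> = (\<Sum>e\<in>F. 2 * (if ends G e \<subseteq> X then 1 else 0)
      + (if ends G e \<inter> X \<noteq> {} \<and> ends G e - X \<noteq> {} then 1 else 0))"
  proof (rule sum.cong[OF refl])
    fix e assume "e \<in> F"
    then obtain u w where e: "ends G e = {u, w}" by (rule multigraph_endsE[OF G subsetD[OF F]])
    have "(\<Sum>v\<in>X. if v \<in> {u, w} then 1 else (0::nat)) = card (X \<inter> {u, w})"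
      using fin by (simp only: card_eq_sum sum.inter_restrict)
    moreover have "(\<Sum>v\<in>X. if {u, w} = {v} then 1 else (0::nat)) = (if u = w \<and> u \<in> X then 1 else 0)"
    proof (cases "u = w")
      case True
      then have "({u, w} = {v}) = (u = v)" for v by auto
      then show ?thesis using True fin by simp
    next
      case False
      then show ?thesis by (auto intro: sum.neutral)
    qed
    ultimately show "(\<Sum>v\<in>X. (if v \<in> ends G e then 1 else 0) + (if ends G e = {v} then 1 else 0))
      = 2 * (if ends G e \<subseteq> X then 1 else 0)
      + (if ends G e \<inter> X \<noteq> {} \<and> ends G e - X \<noteq> {} then 1 else (0::nat))"
      unfolding e sum.distrib by (cases "u \<in> X"; cases "w \<in> X"; cases "u = w") simp_all
  qed
  also have "\<dots> = 2 * card {e \<in> F. ends G e \<subseteq> X} + card (boundary G F X)"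
    by (simp only: boundary_def c sum.distrib sum_distrib_left)
  finally show ?thesis .
qed

lemma degree_in_Un:
  assumes "finite A" "finite B" "A \<inter> B = {}"
  shows "degree_in G (A \<union> B) v = degree_in G A v + degree_in G B v"
proof -
  have "card {e \<in> A \<union> B. P e} = card {e \<in> A. P e} + card {e \<in> B. P e}" for P
  proof -
    have "{e \<in> A \<union> B. P e} = {e \<in> A. P e} \<union> {e \<in> B. P e}" by auto
    then show ?thesis using assms by (simp add: card_Un_disjoint disjoint_iff)
  qed
  then show ?thesis unfolding degree_in_def by simp
qed

text \<open>Jaeger's criterion. An integral flow with values in \<open>{0, 1}\<close> selects the edges to be reversed in
  an arbitrary orientation so that \<open>\<sigma>\<close> becomes its net outdegree; the balance condition is then
  exactly Hoffman's condition for capacities \<open>1\<close> and \<open>4\<close>.\<close>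

lemma flow_of_balanced_valuation:
  fixes G :: "('v, 'e) mgraph" and \<sigma> :: "'v \<Rightarrow> int"
  assumes G: "multigraph G" "cubic G"
    and \<sigma>: "\<And>v. v \<in> verts G \<Longrightarrow> \<sigma> v = 1 \<or> \<sigma> v = - 1"
    and \<sigma>0: "sum \<sigma> (verts G) = 0"
    and bal: "\<And>X. X \<subseteq> verts G \<Longrightarrow> 5 * sum \<sigma> X \<le> 3 * int (card (boundary G (edges G) X))"
  shows "has_nowhere_zero_flow 5 G"
proof -
  note fin = multigraph_finite[OF G(1)]
  have "\<forall>e\<in>edges G. \<exists>p. fst p \<in> verts G \<and> snd p \<in> verts G \<and> ends G e = {fst p, snd p}"
    using G(1) unfolding multigraph_def by fastforce
  then obtain p where p: "\<forall>e\<in>edges G. fst (p e) \<in> verts G \<and> snd (p e) \<in> verts G \<and> ends G e = {fst (p e), snd (p e)}"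
    by metis
  define t0 h0 where "t0 e = fst (p e)" and "h0 e = snd (p e)" for e
  have th0: "t0 e \<in> verts G" "h0 e \<in> verts G" "ends G e = {t0 e, h0 e}" if "e \<in> edges G" for e
    using p that by (auto simp: t0_def h0_def)
  have bd: "int (card (boundary G (edges G) S))
      = (\<Sum>e\<in>edges G. if (t e \<in> S) \<noteq> (h e \<in> S) then 1 else 0)"
    if "\<And>e. e \<in> edges G \<Longrightarrow> ends G e = {t e, h e}" for t h S
  proof -
    have "boundary G (edges G) S = {e \<in> edges G. (t e \<in> S) \<noteq> (h e \<in> S)}"
      unfolding boundary_def using that by auto
    then show ?thesis using fin by (simp only: card_eq_sum sum.inter_filter of_nat_sum) (intro sum.cong, auto)
  qed
  \<comment> \<open>Reversing the edges with \<open>y e = 1\<close> subtracts twice the net outflow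
    of \<open>y\<close> from the net outdegree, so the result is \<sigma> exactly if
    \<open>y\<close> has net outflow \<open>b\<close>. The division is exact by parity, as all
    degrees are 3.\<close>
  define b where "b v = (net_out (edges G) t0 h0 (\<lambda>_. 1) v - \<sigma> v) div 2" for v
  have b: "2 * b v = net_out (edges G) t0 h0 (\<lambda>_. 1) v - \<sigma> v" if v: "v \<in> verts G" for v
  proof -
    have "card {e \<in> edges G. v \<in> ends G e} + card {e \<in> edges G. ends G e = {v}} = 3"
      using G(2) v unfolding cubic_def degree_in_def by blast
    moreover have "card {e \<in> edges G. t0 e = v} + card {e \<in> edges G. h0 e = v}
       = card ({e \<in> edges G. t0 e = v} \<union> {e \<in> edges G. h0 e = v})
        + card ({e \<in> edges G. t0 e = v} \<inter> {e \<in> edges G. h0 e = v})"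
      using fin by (intro card_Un_Int) auto
    moreover have "{e \<in> edges G. t0 e = v} \<union> {e \<in> edges G. h0 e = v} = {e \<in> edges G. v \<in> ends G e}"
      using th0(3) by auto
    moreover have "{e \<in> edges G. t0 e = v} \<inter> {e \<in> edges G. h0 e = v} = {e \<in> edges G. ends G e = {v}}"
      using th0(3) by (auto simp: doubleton_eq_iff)
    ultimately have "card {e \<in> edges G. t0 e = v} + card {e \<in> edges G. h0 e = v} = 3" by simp
    moreover have "net_out (edges G) t0 h0 (\<lambda>_. 1) v
        = int (card {e \<in> edges G. t0 e = v}) - int (card {e \<in> edges G. h0 e = v})"
      unfolding net_out_def by simp
    ultimately show ?thesis using \<sigma>[OF v] unfolding b_def by presburger
  qed
  have sum_b: "2 * sum b S = demand_bound (edges G) t0 h0 (\<lambda>_. 1) (\<lambda>_. 1) S - sum \<sigma> S"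
    if S: "S \<subseteq> verts G" for S
  proof -
    have "2 * sum b S = (\<Sum>v\<in>S. net_out (edges G) t0 h0 (\<lambda>_. 1) v - \<sigma> v)"
      unfolding sum_distrib_left using b S by (intro sum.cong) auto
    then show ?thesis
      using sum_net_out[OF fin(2) finite_subset[OF S fin(1)]] by (simp add: sum_subtractf)
  qed
  have "demand_bound (edges G) t0 h0 (\<lambda>_. 1) (\<lambda>_. 1) (verts G) = 0"
    unfolding demand_bound_def using th0 by (intro sum.neutral) auto
  then have b0: "sum b (verts G) = 0" using sum_b[of "verts G"] \<sigma>0 by simp
  have "\<exists>y. (\<forall>e\<in>edges G. 0 \<le> y e \<and> y e \<le> 1) \<and> (\<forall>v\<in>verts G. net_out (edges G) t0 h0 y v = b v)"
  proof (rule feasible_integer_flow[OF fin(2,1) _ _ _ b0])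
    fix S assume S: "S \<subseteq> verts G"
    \<comment> \<open>For capacities 0 and 1 Hoffman's condition amounts to this inequality, which
      is weaker than balance.\<close>
    have "sum \<sigma> S \<le> int (card (boundary G (edges G) S))" using bal[OF S] by linarith
    moreover have "int (card (boundary G (edges G) S))
        = demand_bound (edges G) t0 h0 (\<lambda>_. 1) (\<lambda>_. 1) S - 2 * demand_bound (edges G) t0 h0 (\<lambda>_. 0) (\<lambda>_. 1) S"
      unfolding bd[where t = t0 and h = h0, OF th0(3), simplified] demand_bound_def sum_distrib_left sum_subtractf[symmetric]
      by (intro sum.cong) auto
    ultimately show "demand_bound (edges G) t0 h0 (\<lambda>_. 0) (\<lambda>_. 1) S \<le> sum b S"
      using sum_b[OF S] by linarith
  qed (use th0 in auto)
  then obtain y where y: "\<forall>e\<in>edges G. 0 \<le> y e \<and> y e \<le> 1" "\<forall>v\<in>verts G. net_out (edges G) t0 h0 y v = b v"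
    by blast
  define t h where "t e = (if y e = 1 then h0 e else t0 e)" and "h e = (if y e = 1 then t0 e else h0 e)" for e
  have th: "t e \<in> verts G" "h e \<in> verts G" "ends G e = {t e, h e}" if "e \<in> edges G" for e
    using th0[OF that] by (auto simp: t_def h_def)
  have cut: "demand_bound (edges G) t h (\<lambda>_. 1) (\<lambda>_. 1) S = sum \<sigma> S" if S: "S \<subseteq> verts G" for S
  proof -
    have "demand_bound (edges G) t h (\<lambda>_. 1) (\<lambda>_. 1) S
      = demand_bound (edges G) t0 h0 (\<lambda>_. 1) (\<lambda>_. 1) S - 2 * demand_bound (edges G) t0 h0 y y S"
      unfolding demand_bound_def sum_distrib_left sum_subtractf[symmetric]
    proof (intro sum.cong refl)
      fix e assume "e \<in> edges G"
      then have "y e = 0 \<or> y e = 1" using y(1) by force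
      then show "(if t e \<in> S \<and> h e \<notin> S then 1 else if t e \<notin> S \<and> h e \<in> S then - 1 else 0) =
         (if t0 e \<in> S \<and> h0 e \<notin> S then 1 else if t0 e \<notin> S \<and> h0 e \<in> S then - 1 else 0) -
         2 * (if t0 e \<in> S \<and> h0 e \<notin> S then y e else if t0 e \<notin> S \<and> h0 e \<in> S then - y e else 0)"
        by (auto simp: t_def h_def)
    qed
    also have "demand_bound (edges G) t0 h0 y y S = sum b S"
      using sum_net_out[OF fin(2) finite_subset[OF S fin(1)], of t0 h0 y] y(2) S
      by (metis (no_types, lifting) subsetD sum.cong)
    finally show ?thesis using sum_b[OF S] by simp
  qed
  have "\<exists>f. (\<forall>e\<in>edges G. 1 \<le> f e \<and> f e \<le> 4) \<and> (\<forall>v\<in>verts G. net_out (edges G) t h f v = 0)"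
  proof (rule feasible_integer_flow[OF fin(2,1)])
    fix S assume S: "S \<subseteq> verts G"
    \<comment> \<open>A leaving edge counts 5 - 3 = 2 and an entering edge -5 - 3 = -8, which is
      twice the lower bound 1 and twice the negated upper bound 4.\<close>
    have "5 * demand_bound (edges G) t h (\<lambda>_. 1) (\<lambda>_. 1) S - 3 * int (card (boundary G (edges G) S))
        = 2 * demand_bound (edges G) t h (\<lambda>_. 1) (\<lambda>_. 4) S"
      unfolding bd[where t = t and h = h, OF th(3), simplified] demand_bound_def sum_distrib_left sum_subtractf[symmetric]
      by (intro sum.cong) auto
    then show "demand_bound (edges G) t h (\<lambda>_. 1) (\<lambda>_. 4) S \<le> (\<Sum>v\<in>S. 0)"
      using bal[OF S] cut[OF S] by simp
  qed (use th in auto)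
  then obtain f where f: "\<forall>e\<in>edges G. 1 \<le> f e \<and> f e \<le> 4" "\<forall>v\<in>verts G. net_out (edges G) t h f v = 0"
    by blast
  have nat_f: "int (\<Sum>e | e \<in> edges G \<and> g e = v. nat (f e)) = (\<Sum>e | e \<in> edges G \<and> g e = v. f e)"
    for g and v :: 'v
    unfolding of_nat_sum using f(1) by (intro sum.cong refl) force
  have "(\<Sum>e | e \<in> edges G \<and> h e = v. nat (f e)) = (\<Sum>e | e \<in> edges G \<and> t e = v. nat (f e))"
    if "v \<in> verts G" for v
  proof -
    have "int (\<Sum>e | e \<in> edges G \<and> h e = v. nat (f e)) = int (\<Sum>e | e \<in> edges G \<and> t e = v. nat (f e))"
      unfolding nat_f using f(2) that by (simp add: net_out_def)
    then show ?thesis by linarith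
  qed
  moreover have "\<forall>e\<in>edges G. nat (f e) \<in> {1..5 - 1}" using f(1) by force
  moreover have "orientation G t h" using th(3) by (simp add: orientation_def)
  ultimately show ?thesis
    unfolding has_nowhere_zero_flow_def by (intro exI[of _ t] exI[of _ h] exI[of _ "\<lambda>e. nat (f e)"]) blast
qed

section \<open>Boundaries of complements, intersections and unions\<close>

lemma boundary_mono: "F \<subseteq> F' \<Longrightarrow> boundary G F X \<subseteq> boundary G F' X"
  by (auto simp: boundary_def)

lemma boundary_Diff_verts:
  assumes "multigraph G" "F \<subseteq> edges G" "X \<subseteq> verts G"
  shows "boundary G F (verts G - X) = boundary G F X"
  unfolding boundary_def using multigraph_ends(1)[OF assms(1)] assms(2,3) by blast

text \<open>Submodularity of cuts. The edge \<open>a\<close> lies in the boundaries of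
  \<open>S\<close> and \<open>T\<close> but in neither boundary on the left, which gains 2.\<close>

lemma boundary_uncross:
  assumes G: "multigraph G" and F: "F \<subseteq> edges G"
    and a: "a \<in> F" "ends G a = {x, y}" "x \<in> S - T" "y \<in> T - S"
  shows "card (boundary G F (S \<inter> T)) + card (boundary G F (S \<union> T)) + 2
    \<le> card (boundary G F S) + card (boundary G F T)"
proof -
  have fin: "finite F" using multigraph_finite[OF G] F finite_subset by auto
  have c: "card (boundary G F X) = (\<Sum>e\<in>F. if ends G e \<inter> X \<noteq> {} \<and> ends G e - X \<noteq> {} then 1 else 0)" for X
    unfolding boundary_def using fin by (simp only: card_eq_sum sum.inter_filter)
  have two: "2 = (\<Sum>e\<in>F. if e = a then 2 else (0::nat))" using fin a(1) by simp
  show ?thesis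
    unfolding c
    apply (subst two)
    apply (unfold sum.distrib[symmetric])
    apply (rule sum_mono)
    subgoal premises e for e
    proof -
      obtain u w where "ends G e = {u, w}"
        by (rule multigraph_endsE[OF G subsetD[OF F e]])
      then show ?thesis using a(2-4)
        by (cases "e = a"; cases "u \<in> S"; cases "u \<in> T"; cases "w \<in> S"; cases "w \<in> T")
          (auto simp: doubleton_eq_iff)
    qed
    done
qed

subsection \<open>Circuits and small cuts\<close>

definition path_in :: "('v, 'e) mgraph \<Rightarrow> 'v set \<Rightarrow> 'v list \<Rightarrow> 'e list \<Rightarrow> bool" where
  "path_in G X vs es \<longleftrightarrow> length vs = Suc (length es) \<and> distinct vs \<and> set vs \<subseteq> X \<and> set es \<subseteq> edges G \<and>
     (\<forall>i<length es. ends G (es ! i) = {vs ! i, vs ! Suc i})"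

lemma path_in_distinct_edges:
  assumes "path_in G X vs es"
  shows "distinct es"
  unfolding distinct_conv_nth
proof (intro allI impI)
  fix i k assume ik: "i < length es" "k < length es" "i \<noteq> k"
  have d: "distinct vs" "length vs = Suc (length es)" using assms by (auto simp: path_in_def)
  have "{vs ! i, vs ! Suc i} \<noteq> {vs ! k, vs ! Suc k}"
    unfolding doubleton_eq_iff using ik d by (simp add: nth_eq_iff_index_eq)
  moreover have "ends G (es ! i) = {vs ! i, vs ! Suc i}" "ends G (es ! k) = {vs ! k, vs ! Suc k}"
    using assms ik by (auto simp: path_in_def)
  ultimately show "es ! i \<noteq> es ! k" by auto
qed

lemma contains_circuit_loop:
  assumes "e \<in> edges G" "ends G e = {v}" "v \<in> X" "X \<subseteq> verts G"
  shows "contains_circuit G X"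
  unfolding contains_circuit_def circuit_def
  using assms by (intro exI[of _ "[v]"] exI[of _ "[e]"]) auto

text \<open>The edge \<open>e\<close> closes the initial segment up to \<open>vs ! j\<close>.
  Excluding the first edge matters for \<open>j = 1\<close>, where \<open>e\<close> must be a
  parallel edge and not the same edge walked back; \<open>take 1\<close> makes sense for an empty
  list too.\<close>

lemma contains_circuit_of_path:
  assumes p: "path_in G X vs es" and X: "X \<subseteq> verts G"
    and e: "e \<in> edges G" "ends G e = {vs ! 0, vs ! j}" "0 < j" "j < length vs" "e \<notin> set (take 1 es)"
  shows "contains_circuit G X"
proof -
  have d: "distinct vs" "length vs = Suc (length es)" "set vs \<subseteq> X" "set es \<subseteq> edges G"
    and ends: "\<And>i. i < length es \<Longrightarrow> ends G (es ! i) = {vs ! i, vs ! Suc i}"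
    using p by (auto simp: path_in_def)
  have "e \<noteq> es ! i" if i: "i < j" for i
  proof
    assume "e = es ! i"
    then have "{vs ! 0, vs ! j} = {vs ! i, vs ! Suc i}" using ends e i d by simp
    then have "i = 0" unfolding doubleton_eq_iff using i e d by (auto simp: nth_eq_iff_index_eq)
    then show False using \<open>e = es ! i\<close> e d by (cases es) auto
  qed
  then have "e \<notin> set (take j es)" by (auto simp: in_set_conv_nth)
  moreover have "ends G ((take j es @ [e]) ! i) = {take (Suc j) vs ! i, take (Suc j) vs ! (Suc i mod Suc j)}"
    if "i < Suc j" for i
    using that ends[of i] e d by (cases "i = j") (auto simp: nth_append)
  moreover have "set (take (Suc j) vs) \<subseteq> X" "set (take j es) \<subseteq> edges G"
    using d set_take_subset by fastforce+
  ultimately have "circuit G (take (Suc j) vs) (take j es @ [e])"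
    unfolding circuit_def using e d X path_in_distinct_edges[OF p] by auto
  then show ?thesis using \<open>set (take (Suc j) vs) \<subseteq> X\<close> unfolding contains_circuit_def by blast
qed

text \<open>In a longest path inside \<open>X\<close> the first vertex has an edge other than the
  first edge of the path. By maximality it leads back to the path, unless it is a loop, which is a
  circuit already.\<close>

lemma contains_circuit_of_min_degree:
  assumes G: "multigraph G" and X: "X \<subseteq> verts G" "X \<noteq> {}"
    and deg: "\<And>v. v \<in> X \<Longrightarrow> 2 \<le> card {e \<in> edges G. ends G e \<subseteq> X \<and> v \<in> ends G e}"
  shows "contains_circuit G X"
proof -
  have finX: "finite X" using X multigraph_finite[OF G] finite_subset by blast
  obtain x where x: "x \<in> X" using X by blast
  let ?P = "\<lambda>p. path_in G X (fst p) (snd p)"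
  have ex: "?P ([x], [])" using x by (simp add: path_in_def)
  have bounded: "\<forall>p. ?P p \<longrightarrow> length (fst p) < Suc (card X)"
  proof (intro allI impI)
    fix p assume "?P p"
    then have "distinct (fst p)" "set (fst p) \<subseteq> X" by (auto simp: path_in_def)
    then have "length (fst p) \<le> card X" using card_mono[OF finX] distinct_card by metis
    then show "length (fst p) < Suc (card X)" by simp
  qed
  obtain p where p: "?P p" "\<forall>q. ?P q \<longrightarrow> length (fst q) \<le> length (fst p)"
    using ex_has_greatest_nat[of ?P, OF ex bounded] by blast
  obtain vs es where p_eq: "p = (vs, es)" by (cases p)
  have path: "path_in G X vs es" using p(1) p_eq by simp
  have max: "length vs' \<le> length vs" if "path_in G X vs' es'" for vs' es'
    using p(2)[rule_format, of "(vs', es')"] that p_eq by simp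
  obtain v vs0 where vs: "vs = v # vs0" using path by (cases vs) (auto simp: path_in_def)
  have v: "v \<in> X" using path vs by (simp add: path_in_def)
  \<comment> \<open>The path uses at most one edge at \<open>v\<close>, so of the two edges required
    there one remains.\<close>
  have "card (set (take 1 es)) \<le> 1" using card_length[of "take 1 es"] by simp
  moreover have "card {e \<in> edges G. ends G e \<subseteq> X \<and> v \<in> ends G e} \<le> card (set (take 1 es))"
    if "{e \<in> edges G. ends G e \<subseteq> X \<and> v \<in> ends G e} \<subseteq> set (take 1 es)"
    using that by (intro card_mono) simp_all
  ultimately have "\<not> {e \<in> edges G. ends G e \<subseteq> X \<and> v \<in> ends G e} \<subseteq> set (take 1 es)"
    using deg[OF v] by linarith
  then obtain e where e: "e \<in> edges G" "ends G e \<subseteq> X" "v \<in> ends G e" "e \<notin> set (take 1 es)" by blast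
  obtain w where w: "ends G e = {v, w}"
    by (rule multigraph_endsE[OF G e(1)]) (use e(3) in auto)
  show ?thesis
  proof (cases "w = v")
    case True
    then show ?thesis using contains_circuit_loop[OF e(1) _ v X(1)] w by simp
  next
    case False
    show ?thesis
    proof (cases "w \<in> set vs")
      case True
      then obtain j where "j < length vs" "vs ! j = w" by (auto simp: in_set_conv_nth)
      moreover have "j \<noteq> 0" using calculation False vs by (cases j) auto
      ultimately show ?thesis
        using contains_circuit_of_path[OF path X(1) e(1) _ _ _ e(4), of j] w vs by simp
    next
      case new: False
      have "path_in G X (w # vs) (e # es)"
        using path e w new unfolding path_in_def
        by (auto simp: nth_Cons vs insert_commute split: nat.split)
      then show ?thesis using max by fastforce
    qed
  qed
qed

text \<open>A forest has fewer edges than vertices. Deleting a vertex with at most one edge inside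
  \<open>X\<close> preserves the inequality; if a single vertex is left, the edge it spans is a
  loop.\<close>

lemma contains_circuit_of_card:
  assumes G: "multigraph G" and "X \<subseteq> verts G" "X \<noteq> {}"
    and "card X \<le> card {e \<in> edges G. ends G e \<subseteq> X}"
  shows "contains_circuit G X"
  using assms(2-)
proof (induction "card X" arbitrary: X rule: less_induct)
  case less
  note fin = multigraph_finite[OF G]
  have finX: "finite X" using less.prems(1) fin finite_subset by blast
  let ?I = "\<lambda>X. {e \<in> edges G. ends G e \<subseteq> X}"
  show ?case
  proof (cases "\<forall>v\<in>X. 2 \<le> card {e \<in> edges G. ends G e \<subseteq> X \<and> v \<in> ends G e}")
    case True
    then show ?thesis using contains_circuit_of_min_degree[OF G less.prems(1,2)] by blast
  next
    case False
    then obtain v where v: "v \<in> X" "\<not> 2 \<le> card {e \<in> edges G. ends G e \<subseteq> X \<and> v \<in> ends G e}" by blast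
    have I: "?I X = ?I (X - {v}) \<union> {e \<in> edges G. ends G e \<subseteq> X \<and> v \<in> ends G e}" by auto
    have "card (?I X) \<le> card (?I (X - {v})) + card {e \<in> edges G. ends G e \<subseteq> X \<and> v \<in> ends G e}"
      unfolding I by (rule card_Un_le)
    moreover have "card (X - {v}) = card X - 1" using v(1) by simp
    ultimately have c: "card (X - {v}) \<le> card (?I (X - {v}))" using v(2) less.prems(3) by linarith
    show ?thesis
    proof (cases "X = {v}")
      case True
      then have "card (?I X) > 0" using less.prems(3) by simp
      then obtain e where "e \<in> ?I X" by (metis card_gt_0_iff ex_in_conv)
      moreover have "ends G e \<noteq> {}" using calculation multigraph_ends[OF G] by blast
      ultimately show ?thesis using contains_circuit_loop[of e G v X] True less.prems(1) by auto
    next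
      case False
      have "card (X - {v}) < card X" using finX v(1) by (rule card_Diff1_less)
      then have "contains_circuit G (X - {v})" using less.hyps[of "X - {v}"] c less.prems v False by auto
      then show ?thesis unfolding contains_circuit_def by blast
    qed
  qed
qed

text \<open>A circuit is connected, so it lies in one component, and closedness keeps this component
  inside \<open>X\<close>. Nonemptiness makes components found in disjoint sets different.\<close>

lemma component_with_circuit:
  assumes c: "contains_circuit G X" and X: "X \<subseteq> verts G"
    and closed: "\<And>e. e \<in> edges G \<Longrightarrow> ends G e \<inter> X \<noteq> {} \<Longrightarrow> ends G e \<subseteq> X"
  obtains C where "C \<in> components G" "C \<subseteq> X" "C \<noteq> {}" "contains_circuit G C"
proof -
  obtain vs es where vs: "circuit G vs es" "set vs \<subseteq> X" using c unfolding contains_circuit_def by blast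
  have len: "length es = length vs" "vs \<noteq> []" and es: "set es \<subseteq> edges G"
    and ends: "\<And>i. i < length vs \<Longrightarrow> ends G (es ! i) = {vs ! i, vs ! (Suc i mod length vs)}"
    using vs(1) unfolding circuit_def by auto
  define R where "R = {(u, v). u \<in> verts G \<and> v \<in> verts G \<and> (u, v) \<in> (adjacency G)\<^sup>*}"
  define C where "C = R `` {vs ! 0}"
  have v0: "vs ! 0 \<in> X" using vs len by (auto intro: nth_mem)
  have "C \<in> components G"
    unfolding C_def components_def R_def[symmetric] using v0 X by (auto intro: quotientI)
  moreover have "C \<subseteq> X"
  proof
    fix y assume "y \<in> C"
    then have "(vs ! 0, y) \<in> (adjacency G)\<^sup>*" by (auto simp: C_def R_def)
    then show "y \<in> X"
    proof (induction rule: rtrancl_induct)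
      case base show ?case by (rule v0)
    next
      case (step y z)
      then obtain e where "e \<in> edges G" "ends G e = {y, z}" by (auto simp: adjacency_def)
      then show ?case using closed[of e] step.IH by auto
    qed
  qed
  moreover have mem: "vs ! i \<in> C" if "i < length vs" for i
  proof -
    have "(vs ! 0, vs ! i) \<in> (adjacency G)\<^sup>*" using that
    proof (induction i)
      case (Suc i)
      have "(vs ! i, vs ! Suc i) \<in> adjacency G"
        using ends[of i] Suc.prems es len unfolding adjacency_def
        by (auto intro!: bexI[of _ "es ! i"] dest: nth_mem)
      then show ?case using Suc by (auto intro: rtrancl_into_rtrancl)
    qed simp
    moreover have "vs ! i \<in> verts G" "vs ! 0 \<in> verts G" using vs X that v0 by (auto dest: nth_mem)
    ultimately show ?thesis by (simp add: C_def R_def)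
  qed
  moreover have "C \<noteq> {}" using mem[of 0] len by auto
  moreover have "set vs \<subseteq> C" using mem by (auto simp: in_set_conv_nth)
  ultimately show ?thesis using that vs(1) unfolding contains_circuit_def by blast
qed

text \<open>A side of the cut without circuits spans fewer edges than it has vertices.\<close>

lemma small_cut:
  assumes G: "multigraph G" "cubic G" "cyclically_edge_connected k G"
    and X: "X \<subseteq> verts G" "X \<noteq> {}" "verts G - X \<noteq> {}"
    and d: "card (boundary G (edges G) X) < k"
  shows "card X + 2 \<le> card (boundary G (edges G) X) \<or>
    card (verts G - X) + 2 \<le> card (boundary G (edges G) X)"
proof (rule ccontr)
  let ?F = "boundary G (edges G) X"
  let ?H = "delete_edges G ?F"
  assume not: "\<not> ?thesis"
  have H: "multigraph ?H" "verts ?H = verts G" "edges ?H = edges G - ?F" "ends ?H = ends G"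
    using G(1) by (auto simp: delete_edges_def multigraph_def)
  have circ: "\<exists>C\<in>components ?H. C \<subseteq> Y \<and> C \<noteq> {} \<and> contains_circuit ?H C"
    if Y: "Y \<subseteq> verts G" "Y \<noteq> {}" and F: "boundary G (edges G) Y = ?F" and cY: "card ?F < card Y + 2" for Y
  proof -
    have deg: "(\<Sum>v\<in>Y. degree_in G (edges G) v) = 3 * card Y"
      using G(2) Y by (simp add: cubic_def subset_iff)
    have memF: "e \<in> ?F \<longleftrightarrow> e \<in> edges G \<and> ends G e \<inter> Y \<noteq> {} \<and> ends G e - Y \<noteq> {}" for e
      by (subst F[symmetric]) (simp add: boundary_def)
    \<comment> \<open>Writing \<open>e\<close> for the number of edges inside \<open>Y\<close> and
      \<open>d\<close> for the size of the cut, \<open>3 |Y| = 2 e + d\<close> and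
      \<open>d \<le> |Y| + 1\<close> give \<open>2 e \<ge> 2 |Y| - 1\<close>, hence
      \<open>e \<ge> |Y|\<close>.\<close>
    have "card Y \<le> card {e \<in> edges G. ends G e \<subseteq> Y}"
      using sum_degree_in[OF G(1) order.refl Y(1)] deg cY unfolding F by linarith
    also have "{e \<in> edges G. ends G e \<subseteq> Y} = {e \<in> edges ?H. ends ?H e \<subseteq> Y}"
      unfolding H using memF by blast
    finally have "contains_circuit ?H Y" using contains_circuit_of_card[OF H(1)] Y H(2) by simp
    then show ?thesis
    proof (rule component_with_circuit)
      show "Y \<subseteq> verts ?H" using Y H by simp
      show "ends ?H e \<subseteq> Y" if "e \<in> edges ?H" "ends ?H e \<inter> Y \<noteq> {}" for e
        using that memF unfolding H by blast
    qed blast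
  qed
  obtain C where C: "C \<in> components ?H" "C \<subseteq> X" "C \<noteq> {}" "contains_circuit ?H C"
    using circ[OF X(1,2) refl] not by fastforce
  obtain D where D: "D \<in> components ?H" "D \<subseteq> verts G - X" "D \<noteq> {}" "contains_circuit ?H D"
    using circ[OF _ X(3) boundary_Diff_verts[OF G(1) order.refl X(1)]] not by fastforce
  have "edge_cut G ?F" unfolding edge_cut_def boundary_def using X by blast
  moreover have "C \<noteq> D" using C D by blast
  ultimately show False using G(3) C D d unfolding cyclically_edge_connected_def by blast
qed

subsection \<open>Two-colourings of a union of two 1-factors\<close>

text \<open>A loop at \<open>v\<close> would be counted by both summands of \<open>degree_in\<close>
  and give degree 2.\<close>

lemma one_factor_unique_edge:
  assumes "multigraph G" "one_factor G M" "v \<in> verts G"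
  shows "card {e \<in> M. v \<in> ends G e} = 1" "{e \<in> M. ends G e = {v}} = {}"
proof -
  have fin: "finite M" using assms multigraph_finite finite_subset unfolding one_factor_def by metis
  have "card {e \<in> M. v \<in> ends G e} + card {e \<in> M. ends G e = {v}} = 1"
    using assms unfolding one_factor_def degree_in_def by blast
  moreover have "card {e \<in> M. ends G e = {v}} \<le> card {e \<in> M. v \<in> ends G e}"
    using fin by (intro card_mono) auto
  ultimately have "card {e \<in> M. v \<in> ends G e} = 1" "card {e \<in> M. ends G e = {v}} = 0"
    by linarith+
  then show "card {e \<in> M. v \<in> ends G e} = 1" "{e \<in> M. ends G e = {v}} = {}"
    using fin by auto
qed

lemma one_factor_endsE:
  assumes "multigraph G" "one_factor G M" "e \<in> M"
  obtains u v where "u \<in> verts G" "v \<in> verts G" "u \<noteq> v" "ends G e = {u, v}"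
proof -
  have e: "e \<in> edges G" using assms unfolding one_factor_def by blast
  obtain u v where uv: "u \<in> verts G" "v \<in> verts G" "ends G e = {u, v}"
    by (rule multigraph_endsE[OF assms(1) e])
  moreover have "u \<noteq> v" using one_factor_unique_edge(2)[OF assms(1,2) uv(1)] uv assms(3) by auto
  ultimately show ?thesis using that by blast
qed

text \<open>A 1-factor becomes a fixed-point-free involution, so that 2-colouring the union of two
  1-factors becomes a question about two involutions.\<close>

lemma one_factor_partner:
  assumes G: "multigraph G" "one_factor G M"
  obtains a where "\<And>v. v \<in> verts G \<Longrightarrow> a v \<in> verts G \<and> a v \<noteq> v \<and> a (a v) = v"
    "\<And>e v. e \<in> M \<Longrightarrow> v \<in> ends G e \<Longrightarrow> ends G e = {v, a v}"
proof -
  have "\<exists>w. w \<noteq> v \<and> w \<in> verts G \<and> (\<exists>e\<in>M. ends G e = {v, w}) \<and> (\<forall>e\<in>M. v \<in> ends G e \<longrightarrow> ends G e = {v, w})"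
    if v: "v \<in> verts G" for v
  proof -
    obtain e where e: "{e \<in> M. v \<in> ends G e} = {e}"
      using one_factor_unique_edge(1)[OF G v] card_1_singletonE by metis
    then have eM: "e \<in> M" "v \<in> ends G e" by auto
    obtain x y where xy: "x \<in> verts G" "y \<in> verts G" "x \<noteq> y" "ends G e = {x, y}"
      by (rule one_factor_endsE[OF G eM(1)])
    then obtain w where w: "w \<noteq> v" "w \<in> verts G" "ends G e = {v, w}"
      using eM(2) by (metis empty_iff insert_commute insert_iff)
    then show ?thesis using e eM by (intro exI[of _ w]) auto
  qed
  then obtain a where a: "\<And>v. v \<in> verts G \<Longrightarrow> a v \<noteq> v \<and> a v \<in> verts G \<and> (\<exists>e\<in>M. ends G e = {v, a v}) \<and>
      (\<forall>e\<in>M. v \<in> ends G e \<longrightarrow> ends G e = {v, a v})"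
    by metis
  have inv: "a (a v) = v" if v: "v \<in> verts G" for v
  proof -
    obtain e where e: "e \<in> M" "ends G e = {v, a v}" using a[OF v] by blast
    then have "{v, a v} = {a v, a (a v)}" using a[of "a v"] a[OF v] by (metis insertCI)
    then show ?thesis using a[OF v] by (metis doubleton_eq_iff)
  qed
  have "ends G e = {v, a v}" if "e \<in> M" "v \<in> ends G e" for e v
  proof -
    have "v \<in> verts G" by (rule one_factor_endsE[OF G that(1)]) (use that(2) in auto)
    then show ?thesis using a that by blast
  qed
  then show ?thesis using that a inv by metis
qed

text \<open>Each orbit of \<open>b \<circ> a\<close> is disjoint from its image under \<open>a\<close>; a colour class is a maximal union
  of orbits with this property.\<close>

lemma involutions_common_sign:
  assumes fin: "finite V"
    and a: "\<And>v. v \<in> V \<Longrightarrow> a v \<in> V \<and> a v \<noteq> v \<and> a (a v) = v"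
    and b: "\<And>v. v \<in> V \<Longrightarrow> b v \<in> V \<and> b v \<noteq> v \<and> b (b v) = v"
  shows "\<exists>\<sigma> :: 'v \<Rightarrow> int. \<forall>v\<in>V. (\<sigma> v = 1 \<or> \<sigma> v = - 1) \<and> \<sigma> (a v) = - \<sigma> v \<and> \<sigma> (b v) = - \<sigma> v"
proof -
  define p where "p v = b (a v)" for v
  have pV: "p v \<in> V" if "v \<in> V" for v using a b that by (simp add: p_def)
  have pkV: "(p ^^ k) v \<in> V" if "v \<in> V" for v k using that by (induction k) (auto simp: pV)
  \<comment> \<open>Conjugation by \<open>a\<close> inverts \<open>p\<close>.\<close>
  have pap: "p (a (p v)) = a v" if "v \<in> V" for v using a b that by (simp add: p_def)
  have pkapk: "(p ^^ k) (a ((p ^^ k) v)) = a v" if "v \<in> V" for v k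
    using that
  proof (induction k)
    case (Suc k)
    have "(p ^^ Suc k) (a ((p ^^ Suc k) v)) = (p ^^ k) (p (a (p ((p ^^ k) v))))"
      by (simp add: funpow_swap1)
    also have "\<dots> = a v" using pap[OF pkV[OF Suc.prems, of k]] Suc by simp
    finally show ?case .
  qed simp
  \<comment> \<open>An equation for \<open>x\<close> and \<open>k + 2\<close> turns into one for
    \<open>p x\<close> and \<open>k\<close>, so the induction descends by 2. It ends at a fixed
    point of \<open>a\<close> for \<open>k = 0\<close> or of \<open>b\<close> for
    \<open>k = 1\<close>.\<close>
  have disj: "a x \<noteq> (p ^^ k) x" if "x \<in> V" for x k
    using that
  proof (induction k arbitrary: x rule: induct_nat_012)
    case 0 then show ?case using a by simp
  next
    case 1
    then show ?case using a[of x] b[of "a x"] by (metis p_def funpow_0 funpow.simps(2) comp_apply)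
  next
    case (ge2 k)
    show ?case
    proof
      assume eq: "a x = (p ^^ Suc (Suc k)) x"
      have "p ((p ^^ k) (p x)) = p (a (p x))"
        using eq pap[OF ge2.prems] by (simp add: funpow_swap1)
      then have "b (p ((p ^^ k) (p x))) = b (p (a (p x)))" by simp
      then have "a ((p ^^ k) (p x)) = a (a (p x))"
        using a b pV ge2.prems pkV unfolding p_def[of "(p ^^ k) (p x)"] p_def[of "a (p x)"] by simp
      then have "a (a ((p ^^ k) (p x))) = a (a (a (p x)))" by simp
      then have "(p ^^ k) (p x) = a (p x)" using a pV pkV ge2.prems by metis
      then show False using ge2.IH(1)[OF pV[OF ge2.prems]] by simp
    qed
  qed
  let ?P = "\<lambda>A. A \<subseteq> V \<and> p ` A \<subseteq> A \<and> a ` A \<inter> A = {}"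
  have "\<exists>A. ?P A \<and> (\<forall>B. ?P B \<longrightarrow> card B \<le> card A)"
    using fin by (intro ex_has_greatest_nat[of ?P "{}" card "Suc (card V)"]) (auto simp: less_Suc_eq_le card_mono)
  then obtain A where A: "A \<subseteq> V" "p ` A \<subseteq> A" "a ` A \<inter> A = {}" and max: "\<And>B. ?P B \<Longrightarrow> card B \<le> card A"
    by blast
  have pkA: "(p ^^ k) y \<in> A" if "y \<in> A" for y k using that A(2) by (induction k) auto
  \<comment> \<open>Otherwise the forward orbit of \<open>x\<close> could be added to
    \<open>A\<close>, against maximality.\<close>
  have cover: "x \<in> A \<or> a x \<in> A" if x: "x \<in> V" for x
  proof (rule ccontr)
    assume no: "\<not> ?thesis"
    define O' where "O' = (\<lambda>k. (p ^^ k) x) ` UNIV"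
    have OV: "O' \<subseteq> V" using pkV[OF x] by (auto simp: O'_def)
    have aO: "a y \<notin> A" if "y \<in> O'" for y
    proof
      assume "a y \<in> A"
      moreover obtain k where "y = (p ^^ k) x" using \<open>y \<in> O'\<close> unfolding O'_def by blast
      ultimately have "a x \<in> A" using pkA[of "a y" k] pkapk[OF x, of k] by simp
      then show False using no by simp
    qed
    have "a y \<notin> O'" if "y \<in> O'" for y
    proof
      assume "a y \<in> O'"
      then obtain j k where "a ((p ^^ k) x) = (p ^^ j) x" using \<open>y \<in> O'\<close> unfolding O'_def by blast
      then have "a x = (p ^^ (k + j)) x" using pkapk[OF x, of k] by (simp add: funpow_add)
      then show False using disj[OF x] by simp
    qed
    moreover have "a y \<notin> O'" if y: "y \<in> A" for y
    proof
      assume "a y \<in> O'"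
      then have "a (a y) \<notin> A" by (rule aO)
      then show False using a[of y] y A(1) by auto
    qed
    moreover have "p ` O' \<subseteq> O'"
    proof
      fix z assume "z \<in> p ` O'"
      then obtain k where "z = p ((p ^^ k) x)" unfolding O'_def by blast
      then have "z = (p ^^ Suc k) x" by simp
      then show "z \<in> O'" unfolding O'_def by blast
    qed
    ultimately have "?P (A \<union> O')" using A OV aO by blast
    then have "card (A \<union> O') \<le> card A" by (rule max)
    moreover have "A \<subset> A \<union> O'"
    proof -
      have "x = (p ^^ 0) x" by simp
      then have "x \<in> O'" unfolding O'_def by blast
      then show ?thesis using no by blast
    qed
    ultimately show False using psubset_card_mono[of "A \<union> O'" A] A(1) OV fin finite_subset
      by (metis Un_least not_le)
  qed
  have iff_a: "a v \<in> A \<longleftrightarrow> v \<notin> A" if "v \<in> V" for v using cover[OF that] A(3) by blast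
  have inj: "inj_on p V" unfolding inj_on_def p_def using a b by metis
  \<comment> \<open>An injection of a finite set into itself is onto, so \<open>A\<close> is also
    closed under going backwards along \<open>p\<close>. This carries the colour rule from
    \<open>a\<close> over to \<open>b\<close>, since \<open>b v = p (a v)\<close>.\<close>
  have pA: "p ` A = A"
    using endo_inj_surj[OF finite_subset[OF A(1) fin] A(2)] inj_on_subset[OF inj A(1)] by blast
  have iff_p: "p v \<in> A \<longleftrightarrow> v \<in> A" if v: "v \<in> V" for v
  proof
    assume "p v \<in> A"
    then have "p v \<in> p ` A" unfolding pA .
    then obtain w where w: "w \<in> A" "p v = p w" by blast
    then have "v = w" using inj_onD[OF inj w(2) v] A(1) by blast
    then show "v \<in> A" using w by simp
  qed (use A in auto)
  have iff_b: "b v \<in> A \<longleftrightarrow> v \<notin> A" if v: "v \<in> V" for v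
  proof -
    have "b v = p (a v)" using a[OF v] by (simp add: p_def)
    then show ?thesis using iff_p[of "a v"] iff_a[OF v] a[OF v] by simp
  qed
  show ?thesis
    using iff_a iff_b by (intro exI[of _ "\<lambda>v. if v \<in> A then 1 else - 1"]) auto
qed

text \<open>For signs 1 and -1 on loopless edges this says that adjacent vertices have opposite
  signs; the sum avoids naming the two ends.\<close>

definition alternating :: "('v, 'e) mgraph \<Rightarrow> 'e set \<Rightarrow> ('v \<Rightarrow> int) \<Rightarrow> bool" where
  "alternating G M \<sigma> \<longleftrightarrow> (\<forall>e\<in>M. sum \<sigma> (ends G e) = 0)"

lemma one_factor_finite: "multigraph G \<Longrightarrow> one_factor G M \<Longrightarrow> finite M"
  unfolding one_factor_def using multigraph_finite(2) finite_subset by blast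

lemma sum_one_factor:
  fixes \<sigma> :: "'v \<Rightarrow> int"
  assumes G: "multigraph G" "one_factor G M" and X: "X \<subseteq> verts G"
  shows "sum \<sigma> X = (\<Sum>e\<in>M. sum \<sigma> (ends G e \<inter> X))"
proof -
  have finM: "finite M" by (rule one_factor_finite[OF G])
  have finX: "finite X" using X multigraph_finite(1)[OF G(1)] finite_subset by blast
  have "sum \<sigma> X = (\<Sum>v\<in>X. \<Sum>e\<in>{e \<in> M. v \<in> ends G e}. \<sigma> v)"
    using one_factor_unique_edge(1)[OF G] X by (intro sum.cong) (auto simp: subset_iff)
  also have "\<dots> = (\<Sum>v\<in>X. \<Sum>e\<in>M. if v \<in> ends G e then \<sigma> v else 0)"
    using finM by (simp only: sum.inter_filter)
  also have "\<dots> = (\<Sum>e\<in>M. \<Sum>v\<in>X. if v \<in> ends G e then \<sigma> v else 0)" by (rule sum.swap)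
  also have "\<dots> = (\<Sum>e\<in>M. sum \<sigma> (X \<inter> ends G e))"
    using finX by (simp only: sum.inter_restrict)
  finally show ?thesis by (simp only: Int_commute)
qed

text \<open>The edges of \<open>M\<close> partition the vertices into pairs. A pair inside
  \<open>X\<close> cancels and a pair outside contributes nothing, so only crossing edges
  remain.\<close>

lemma sum_alternating:
  assumes G: "multigraph G" "one_factor G M" "alternating G M \<sigma>" and X: "X \<subseteq> verts G"
  shows "sum \<sigma> X = (\<Sum>e\<in>boundary G M X. sum \<sigma> (ends G e \<inter> X))"
proof -
  have "(\<Sum>e\<in>M. sum \<sigma> (ends G e \<inter> X)) = (\<Sum>e\<in>boundary G M X. sum \<sigma> (ends G e \<inter> X))"
  proof (rule sum.mono_neutral_right[OF one_factor_finite[OF G(1,2)]])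
    show "boundary G M X \<subseteq> M" by (auto simp: boundary_def)
    show "\<forall>e\<in>M - boundary G M X. sum \<sigma> (ends G e \<inter> X) = 0"
    proof
      fix e assume e: "e \<in> M - boundary G M X"
      then have "ends G e \<inter> X = {} \<or> ends G e \<inter> X = ends G e" by (auto simp: boundary_def)
      then show "sum \<sigma> (ends G e \<inter> X) = 0" using G(3) e by (auto simp: alternating_def)
    qed
  qed
  then show ?thesis using sum_one_factor[OF G(1,2) X] by simp
qed

lemma one_factor_boundary_end:
  assumes G: "multigraph G" "one_factor G M" and e: "e \<in> boundary G M X"
  shows "\<exists>v\<in>verts G. ends G e \<inter> X = {v}"
proof -
  have eM: "e \<in> M" using e by (simp add: boundary_def)
  obtain x y where "x \<in> verts G" "y \<in> verts G" "ends G e = {x, y}"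
    by (rule one_factor_endsE[OF G eM])
  then show ?thesis using e by (cases "x \<in> X"; cases "y \<in> X") (auto simp: boundary_def)
qed

lemma alternating_boundary_term_le:
  fixes \<sigma> :: "'v \<Rightarrow> int"
  assumes "multigraph G" "one_factor G M" and \<sigma>: "\<And>v. v \<in> verts G \<Longrightarrow> \<sigma> v = 1 \<or> \<sigma> v = - 1"
    and "e \<in> boundary G M X"
  shows "\<bar>sum \<sigma> (ends G e \<inter> X)\<bar> \<le> 1"
proof -
  obtain v where "v \<in> verts G" "ends G e \<inter> X = {v}" using one_factor_boundary_end[OF assms(1,2,4)] by blast
  then show ?thesis using \<sigma>[of v] by auto
qed

lemma abs_sum_alternating_le:
  fixes \<sigma> :: "'v \<Rightarrow> int"
  assumes G: "multigraph G" "one_factor G M" "alternating G M \<sigma>" and X: "X \<subseteq> verts G"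
    and \<sigma>: "\<And>v. v \<in> verts G \<Longrightarrow> \<sigma> v = 1 \<or> \<sigma> v = - 1"
  shows "\<bar>sum \<sigma> X\<bar> \<le> int (card (boundary G M X))"
proof -
  have "\<bar>sum \<sigma> X\<bar> \<le> (\<Sum>e\<in>boundary G M X. \<bar>sum \<sigma> (ends G e \<inter> X)\<bar>)"
    unfolding sum_alternating[OF G X] by (rule sum_abs)
  also have "\<dots> \<le> (\<Sum>e\<in>boundary G M X. 1)"
    by (intro sum_mono alternating_boundary_term_le[OF G(1,2) \<sigma>])
  finally show ?thesis by simp
qed

text \<open>Each crossing edge contributes at most 1, so equality forces every contribution to be
  1.\<close>

lemma sum_alternating_tight:
  fixes \<sigma> :: "'v \<Rightarrow> int"
  assumes G: "multigraph G" "one_factor G M" "alternating G M \<sigma>" and X: "X \<subseteq> verts G"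
    and \<sigma>: "\<And>v. v \<in> verts G \<Longrightarrow> \<sigma> v = 1 \<or> \<sigma> v = - 1"
    and tight: "sum \<sigma> X = int (card (boundary G M X))"
    and e: "e \<in> boundary G M X" "v \<in> ends G e \<inter> X"
  shows "\<sigma> v = 1"
proof -
  have fin: "finite (boundary G M X)"
    using one_factor_finite[OF G(1,2)] by (simp add: boundary_def)
  have "(\<Sum>e\<in>boundary G M X. 1 - sum \<sigma> (ends G e \<inter> X)) = 0"
    using tight sum_alternating[OF G X] by (simp add: sum_subtractf)
  moreover have "0 \<le> 1 - sum \<sigma> (ends G e \<inter> X)" if "e \<in> boundary G M X" for e
    using alternating_boundary_term_le[where \<sigma> = \<sigma>, OF G(1,2) \<sigma> that] by simp
  ultimately have "1 - sum \<sigma> (ends G e \<inter> X) = 0"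
    using sum_nonneg_eq_0_iff[OF fin, of "\<lambda>e. 1 - sum \<sigma> (ends G e \<inter> X)"] e(1) by blast
  moreover obtain w where "ends G e \<inter> X = {w}" using one_factor_boundary_end[OF G(1,2) e(1)] by blast
  ultimately show ?thesis using e(2) by auto
qed

lemma one_factor_disjoint_ends:
  assumes G: "multigraph G" "one_factor G M" and e: "e \<in> M" "e' \<in> M" "e \<noteq> e'"
  shows "ends G e \<inter> ends G e' = {}"
proof (rule ccontr)
  assume "\<not> ?thesis"
  then obtain v where v: "v \<in> ends G e" "v \<in> ends G e'" by blast
  have "ends G e \<subseteq> verts G" using multigraph_ends(1)[OF G(1)] G(2) e(1) unfolding one_factor_def by blast
  then have "card {e \<in> M. v \<in> ends G e} = 1" using one_factor_unique_edge(1)[OF G] v by blast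
  then obtain x where "{e \<in> M. v \<in> ends G e} = {x}" by (rule card_1_singletonE)
  then show False using e v by (metis (mono_tags, lifting) mem_Collect_eq singletonD)
qed

text \<open>On \<open>e\<close> the zero sum is negated, and every other edge of \<open>M\<close>
  misses the ends of \<open>e\<close>.\<close>

lemma alternating_flip:
  assumes G: "multigraph G" "one_factor G M" and e: "e \<in> M" and alt: "alternating G M \<sigma>"
  shows "alternating G M (\<lambda>v. if v \<in> ends G e then - \<sigma> v else \<sigma> v)"
  unfolding alternating_def
proof
  fix e' assume e': "e' \<in> M"
  have 0: "sum \<sigma> (ends G e') = 0" using alt e' by (simp add: alternating_def)
  show "(\<Sum>v\<in>ends G e'. if v \<in> ends G e then - \<sigma> v else \<sigma> v) = 0"
  proof (cases "e' = e")
    case True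
    then have "(\<Sum>v\<in>ends G e'. if v \<in> ends G e then - \<sigma> v else \<sigma> v) = (\<Sum>v\<in>ends G e'. - \<sigma> v)"
      by (intro sum.cong) auto
    then show ?thesis using 0 by (simp add: sum_negf)
  next
    case False
    then have "(\<Sum>v\<in>ends G e'. if v \<in> ends G e then - \<sigma> v else \<sigma> v) = sum \<sigma> (ends G e')"
      using one_factor_disjoint_ends[OF G e' e] by (intro sum.cong) auto
    then show ?thesis using 0 by simp
  qed
qed

lemma card_boundary_Un:
  assumes "finite A" "finite B" "A \<inter> B = {}"
  shows "card (boundary G (A \<union> B) X) = card (boundary G A X) + card (boundary G B X)"
proof -
  have "boundary G (A \<union> B) X = boundary G A X \<union> boundary G B X" by (auto simp: boundary_def)
  moreover have "boundary G A X \<inter> boundary G B X = {}" using assms(3) by (auto simp: boundary_def)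
  ultimately show ?thesis using assms(1,2) by (simp add: card_Un_disjoint boundary_def)
qed

subsection \<open>Unbalanced sets\<close>

locale cubic_two_one_factors =
  fixes G :: "('v, 'e) mgraph" and M1 M2 :: "'e set"
  assumes G: "multigraph G" "cubic G" "cyclically_edge_connected 6 G"
    and M1: "one_factor G M1" and M2: "one_factor G M2"
    and card_M12: "card (M1 \<inter> M2) \<le> 2"
begin

abbreviation "V \<equiv> verts G"
abbreviation "d X \<equiv> card (boundary G (edges G) X)"

definition "E0 = edges G - (M1 \<union> M2)"
definition "E2 = M1 \<inter> M2"

text \<open>These are the proper 2-colourings of the graph with edge set
  \<open>M1 \<union> M2\<close>.\<close>

definition valuation :: "('v \<Rightarrow> int) \<Rightarrow> bool" where
  "valuation \<sigma> \<longleftrightarrow> (\<forall>v\<in>V. \<sigma> v = 1 \<or> \<sigma> v = - 1) \<and> alternating G M1 \<sigma> \<and> alternating G M2 \<sigma>"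

lemma finV: "finite V" and finE: "finite (edges G)"
  using multigraph_finite[OF G(1)] by auto

lemma M_subset: "M1 \<subseteq> edges G" "M2 \<subseteq> edges G" "E0 \<subseteq> edges G" "E2 \<subseteq> edges G"
  using M1 M2 by (auto simp: one_factor_def E0_def E2_def)

lemma M_finite: "finite M1" "finite M2" "finite E0" "finite E2"
  by (rule finite_subset[OF _ finE], rule M_subset)+

lemma valuation_exists: "\<exists>\<sigma>. valuation \<sigma>"
proof -
  obtain a where a: "\<And>v. v \<in> V \<Longrightarrow> a v \<in> V \<and> a v \<noteq> v \<and> a (a v) = v"
    and a1: "\<And>e v. e \<in> M1 \<Longrightarrow> v \<in> ends G e \<Longrightarrow> ends G e = {v, a v}"
    using one_factor_partner[OF G(1) M1] by metis
  obtain b where b: "\<And>v. v \<in> V \<Longrightarrow> b v \<in> V \<and> b v \<noteq> v \<and> b (b v) = v"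
    and b1: "\<And>e v. e \<in> M2 \<Longrightarrow> v \<in> ends G e \<Longrightarrow> ends G e = {v, b v}"
    using one_factor_partner[OF G(1) M2] by metis
  obtain \<sigma> :: "'v \<Rightarrow> int" where \<sigma>: "\<And>v. v \<in> V \<Longrightarrow> (\<sigma> v = 1 \<or> \<sigma> v = - 1) \<and> \<sigma> (a v) = - \<sigma> v \<and> \<sigma> (b v) = - \<sigma> v"
    using involutions_common_sign[OF finV a b] by blast
  have alt: "alternating G M \<sigma>" if M: "one_factor G M"
    and c: "\<And>v. v \<in> V \<Longrightarrow> c v \<noteq> v \<and> \<sigma> (c v) = - \<sigma> v" "\<And>e v. e \<in> M \<Longrightarrow> v \<in> ends G e \<Longrightarrow> ends G e = {v, c v}" for M c
    unfolding alternating_def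
  proof
    fix e assume e: "e \<in> M"
    obtain x y where xy: "x \<in> V" "y \<in> V" "ends G e = {x, y}" by (rule one_factor_endsE[OF G(1) M e])
    then have "ends G e = {x, c x}" using c(2)[OF e, of x] by simp
    moreover have "x \<noteq> c x" using c(1)[OF xy(1)] by metis
    ultimately show "sum \<sigma> (ends G e) = 0" using c(1)[OF xy(1)] by simp
  qed
  have "valuation \<sigma>"
    unfolding valuation_def using \<sigma> alt[OF M1 _ a1] alt[OF M2 _ b1] a b by blast
  then show ?thesis by blast
qed

lemma valuation_flip:
  assumes "valuation \<sigma>" "e \<in> E2"
  shows "valuation (\<lambda>v. if v \<in> ends G e then - \<sigma> v else \<sigma> v)"
  using assms alternating_flip[OF G(1) M1] alternating_flip[OF G(1) M2]
  unfolding valuation_def E2_def by auto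

lemma sum_valuation_verts:
  assumes "valuation \<sigma>"
  shows "sum \<sigma> V = 0"
proof -
  have "boundary G M1 V = {}" using multigraph_ends(1)[OF G(1)] M_subset(1) by (auto simp: boundary_def)
  then show ?thesis
    using sum_alternating[OF G(1) M1 _ order.refl, of \<sigma>] assms by (simp add: valuation_def)
qed

lemma sum_valuation_compl:
  assumes "valuation \<sigma>" "X \<subseteq> V"
  shows "sum \<sigma> (V - X) = - sum \<sigma> X"
  using sum_valuation_verts[OF assms(1)] sum_diff[OF finV assms(2), of \<sigma>] by simp

lemma valuation_abs_le_card:
  assumes "valuation \<sigma>" "X \<subseteq> V"
  shows "\<bar>sum \<sigma> X\<bar> \<le> int (card X)" "even (sum \<sigma> X + int (card X))"
proof -
  have \<sigma>: "\<sigma> v = 1 \<or> \<sigma> v = - 1" if "v \<in> X" for v using assms that by (auto simp: valuation_def)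
  have "\<bar>sum \<sigma> X\<bar> \<le> (\<Sum>v\<in>X. \<bar>\<sigma> v\<bar>)" by (rule sum_abs)
  also have "\<dots> = (\<Sum>v\<in>X. 1)"
  proof (rule sum.cong[OF refl])
    show "\<bar>\<sigma> v\<bar> = 1" if "v \<in> X" for v using \<sigma>[OF that] by auto
  qed
  finally show "\<bar>sum \<sigma> X\<bar> \<le> int (card X)" by simp
  have "sum \<sigma> X + int (card X) = (\<Sum>v\<in>X. \<sigma> v + 1)" by (simp add: sum.distrib)
  moreover have "even (\<sigma> v + 1)" if "v \<in> X" for v using \<sigma>[OF that] by auto
  then have "even (\<Sum>v\<in>X. \<sigma> v + 1)" by (rule dvd_sum)
  ultimately show "even (sum \<sigma> X + int (card X))" by simp
qed

lemma card_boundary_split: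
  "d X + card (boundary G E2 X) = card (boundary G M1 X) + card (boundary G M2 X) + card (boundary G E0 X)"
proof -
  have "edges G = E0 \<union> (M1 \<union> (M2 - M1))" "M2 = (M2 - M1) \<union> E2"
    using M_subset by (auto simp: E0_def E2_def)
  then have "d X = card (boundary G E0 X) + card (boundary G (M1 \<union> (M2 - M1)) X)"
    "card (boundary G M2 X) = card (boundary G (M2 - M1) X) + card (boundary G E2 X)"
    using card_boundary_Un[of E0 "M1 \<union> (M2 - M1)" G X] card_boundary_Un[of "M2 - M1" E2 G X] M_finite
    by (auto simp: E0_def E2_def)
  moreover have "card (boundary G (M1 \<union> (M2 - M1)) X) = card (boundary G M1 X) + card (boundary G (M2 - M1) X)"
    using M_finite by (intro card_boundary_Un) auto
  ultimately show ?thesis by simp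
qed

lemma handshake:
  assumes "X \<subseteq> V"
  shows "3 * card X = 2 * card {e \<in> edges G. ends G e \<subseteq> X} + d X"
proof -
  have "(\<Sum>v\<in>X. degree_in G (edges G) v) = 3 * card X"
    using G(2) assms by (simp add: cubic_def subset_iff)
  then show ?thesis using sum_degree_in[OF G(1) order.refl assms] by simp
qed

text \<open>The 1-factors occupy two edges at \<open>v\<close>, or a single common one, which leaves
  \<open>E0\<close> degree 1 or 2.\<close>

lemma degree_E0:
  assumes v: "v \<in> V"
  shows "degree_in G E0 v = 1 + degree_in G E2 v"
proof -
  have "edges G = E0 \<union> (M1 \<union> (M2 - M1))" "M2 = (M2 - M1) \<union> E2"
    using M_subset by (auto simp: E0_def E2_def)
  then have "degree_in G (edges G) v = degree_in G E0 v + degree_in G (M1 \<union> (M2 - M1)) v"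
    "degree_in G M2 v = degree_in G (M2 - M1) v + degree_in G E2 v"
    using degree_in_Un[of E0 "M1 \<union> (M2 - M1)" G v] degree_in_Un[of "M2 - M1" E2 G v] M_finite
    by (auto simp: E0_def E2_def)
  moreover have "degree_in G (M1 \<union> (M2 - M1)) v = degree_in G M1 v + degree_in G (M2 - M1) v"
    using M_finite by (intro degree_in_Un) auto
  moreover have "degree_in G (edges G) v = 3" "degree_in G M1 v = 1" "degree_in G M2 v = 1"
    using G(2) M1 M2 v by (auto simp: cubic_def one_factor_def)
  ultimately show ?thesis by simp
qed

text \<open>The degree sum of \<open>E0\<close> over \<open>C\<close> is even and that of
  \<open>E2\<close> is odd, and they differ by \<open>|C|\<close>, so \<open>|C|\<close> is odd. A
  single vertex would carry a loop of \<open>E0\<close>, and the resulting cut with at most one edge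
  contradicts \<open>small_cut\<close>.\<close>

lemma card_closed_ge_3:
  assumes C: "C \<subseteq> V" "boundary G E0 C = {}" "card (boundary G E2 C) = 1"
  shows "3 \<le> card C"
proof -
  have finC: "finite C" using C finV finite_subset by blast
  obtain e where e: "e \<in> boundary G E2 C" using C(3) by (metis card_1_singletonE insertI1)
  then have ne: "C \<noteq> {}" "V - C \<noteq> {}"
    using multigraph_ends(1)[OF G(1)] M_subset(4) by (auto simp: boundary_def)
  have s0: "(\<Sum>v\<in>C. degree_in G E0 v) = 2 * card {e \<in> E0. ends G e \<subseteq> C}"
    using sum_degree_in[OF G(1) M_subset(3) C(1)] C(2) by simp
  have s2: "(\<Sum>v\<in>C. degree_in G E2 v) = 2 * card {e \<in> E2. ends G e \<subseteq> C} + 1"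
    using sum_degree_in[OF G(1) M_subset(4) C(1)] C(3) by simp
  have "(\<Sum>v\<in>C. degree_in G E0 v) = (\<Sum>v\<in>C. 1 + degree_in G E2 v)"
    using C(1) by (intro sum.cong) (auto simp: degree_E0 subset_iff)
  then have "(\<Sum>v\<in>C. degree_in G E0 v) = card C + (\<Sum>v\<in>C. degree_in G E2 v)"
    by (simp add: sum_Suc)
  then have eq: "2 * card {e \<in> E0. ends G e \<subseteq> C} = card C + 2 * card {e \<in> E2. ends G e \<subseteq> C} + 1"
    using s0 s2 by simp
  then have odd: "odd (card C)" by presburger
  have "card C \<noteq> 1"
  proof
    assume 1: "card C = 1"
    then have "1 \<le> card {e \<in> E0. ends G e \<subseteq> C}" using eq by simp
    also have "\<dots> \<le> card {e \<in> edges G. ends G e \<subseteq> C}" using finE M_subset(3) by (intro card_mono) auto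
    finally have "d C \<le> 1" using handshake[OF C(1)] 1 by simp
    then have "card C + 2 \<le> 1 \<or> card (V - C) + 2 \<le> 1"
      using small_cut[OF G C(1) ne] by simp
    then show False by simp
  qed
  moreover have "card C \<noteq> 0" using ne finC by simp
  ultimately show ?thesis using odd by presburger
qed

text \<open>Everything that a violation of the balance condition forces. By the last clause each
  common edge has its end of colour 1 in \<open>X\<close>, so the colouring determines which of the
  ends \<open>X\<close> contains.\<close>

definition bad :: "('v \<Rightarrow> int) \<Rightarrow> 'v set \<Rightarrow> bool" where
  "bad \<sigma> X \<longleftrightarrow> X \<subseteq> V \<and> d X = 6 \<and> boundary G E0 X = {} \<and> E2 \<subseteq> boundary G (edges G) X \<and> card E2 = 2 \<and>
     sum \<sigma> X = 4 \<and> (\<forall>e\<in>E2. \<forall>v\<in>ends G e \<inter> X. \<sigma> v = 1)"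

text \<open>With \<open>s = \<bar>\<sigma>(X)\<bar>\<close>, both 1-factors cross the cut at least \<open>s\<close> times, so \<open>2 s \<le> d X + 2\<close>; cuts
  with fewer than 6 edges are excluded by \<open>s \<le> d X - 2\<close>. Parity leaves only \<open>d X = 6\<close>, \<open>s = 4\<close>.\<close>

lemma unbalanced:
  assumes val: "valuation \<sigma>" and X: "X \<subseteq> V" and unb: "5 * \<bar>sum \<sigma> X\<bar> > 3 * int (d X)"
  shows "d X = 6" "\<bar>sum \<sigma> X\<bar> = 4" "boundary G E0 X = {}" "card (boundary G E2 X) = 2"
    "card (boundary G M1 X) = 4"
proof -
  have sg: "\<And>v. v \<in> V \<Longrightarrow> \<sigma> v = 1 \<or> \<sigma> v = - 1" and alt: "alternating G M1 \<sigma>" "alternating G M2 \<sigma>"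
    using val by (auto simp: valuation_def)
  define s where "s = nat \<bar>sum \<sigma> X\<bar>"
  have s: "\<bar>sum \<sigma> X\<bar> = int s" by (simp add: s_def)
  have u: "5 * s > 3 * d X" using unb s by linarith
  have ne: "X \<noteq> {}" using u unfolding s_def by auto
  have ne': "V - X \<noteq> {}"
  proof
    assume "V - X = {}"
    then have "X = V" using X by blast
    then show False using u sum_valuation_verts[OF val] unfolding s_def by simp
  qed
  \<comment> \<open>A smaller cut would have \<open>s \<le> d X - 2\<close>, and then
    \<open>5 s > 3 d X\<close> forces \<open>d X > 5\<close>.\<close>
  have d_ge: "6 \<le> d X"
  proof (rule ccontr)
    assume d6: "\<not> 6 \<le> d X"
    then have "card X + 2 \<le> d X \<or> card (V - X) + 2 \<le> d X"
      using small_cut[OF G X ne ne'] by simp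
    moreover have "s \<le> card X" using valuation_abs_le_card(1)[OF val X] s by simp
    moreover have "s \<le> card (V - X)"
      using valuation_abs_le_card(1)[OF val, of "V - X"] sum_valuation_compl[OF val X] s by simp
    ultimately show False using u d6 by linarith
  qed
  have par: "even (s + d X)"
  proof -
    have "sum \<sigma> X = int s \<or> sum \<sigma> X = - int s" using s by linarith
    then have "even (s + card X)" using valuation_abs_le_card(2)[OF val X] by auto
    then show ?thesis using handshake[OF X] by presburger
  qed
  have s_le: "s \<le> card (boundary G M1 X)" "s \<le> card (boundary G M2 X)"
    using abs_sum_alternating_le[OF G(1) M1 alt(1) X sg] abs_sum_alternating_le[OF G(1) M2 alt(2) X sg] s by auto
  have "card (boundary G E2 X) \<le> card E2" using M_finite by (intro card_mono) (auto simp: boundary_def)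
  then have b2: "card (boundary G E2 X) \<le> 2" using card_M12 by (simp add: E2_def)
  have s2: "2 * s \<le> d X + 2" using s_le b2 card_boundary_split[of X] by linarith
  \<comment> \<open>From \<open>5 s > 3 d X \<ge> 6 s - 6\<close> follows \<open>s < 6\<close>, and
    \<open>5 s > 18\<close> excludes \<open>s \<le> 3\<close>.\<close>
  then have "s = 4 \<or> s = 5" using u d_ge by linarith
  then have d6: "d X = 6"
  proof
    assume "s = 4"
    then show ?thesis using u d_ge by linarith
  next
    assume s5: "s = 5"
    then have "d X = 8" using u s2 by linarith
    then show ?thesis using par s5 by simp
  qed
  \<comment> \<open>All estimates are now equalities: the left side of
    \<open>card_boundary_split\<close> is at most 6 + 2, and \<open>M1\<close> and \<open>M2\<close>
    alone contribute at least 4 + 4.\<close>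
  then have s4: "s = 4" "card (boundary G E0 X) = 0" "card (boundary G E2 X) = 2" "card (boundary G M1 X) = 4"
    using u card_boundary_split[of X] b2 s_le by linarith+
  have "finite (boundary G E0 X)" using M_finite by (simp add: boundary_def)
  then show "d X = 6" "\<bar>sum \<sigma> X\<bar> = 4" "boundary G E0 X = {}" "card (boundary G E2 X) = 2"
    "card (boundary G M1 X) = 4"
    using d6 s4 s by auto
qed

text \<open>The cut meets \<open>M1\<close> in exactly \<sigma>(X) = 4 edges, so tightness fixes the
  colours at the common edges, which belong to \<open>M1\<close>.\<close>

lemma unbalanced_bad:
  assumes val: "valuation \<sigma>" and X: "X \<subseteq> V" and unb: "5 * \<bar>sum \<sigma> X\<bar> > 3 * int (d X)"
    and pos: "0 < sum \<sigma> X"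
  shows "bad \<sigma> X"
proof -
  note u = unbalanced[OF val X unb]
  have s4: "sum \<sigma> X = 4" using u(2) pos by simp
  have sub: "boundary G E2 X \<subseteq> E2" by (auto simp: boundary_def)
  have le: "card E2 \<le> 2" using card_M12 by (simp add: E2_def)
  have b2: "boundary G E2 X = E2"
    using card_subset_eq[OF M_finite(4) sub] u(4) le card_mono[OF M_finite(4) sub] by simp
  have "\<sigma> v = 1" if e: "e \<in> E2" "v \<in> ends G e \<inter> X" for e v
  proof -
    have "e \<in> boundary G M1 X" using e b2 unfolding boundary_def E2_def by blast
    then show ?thesis
      using sum_alternating_tight[OF G(1) M1 _ X, of \<sigma> e v] val s4 u(5) e by (auto simp: valuation_def)
  qed
  then show ?thesis
    unfolding bad_def using X u b2 s4 boundary_mono[OF M_subset(4), of G X] by auto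
qed

lemma bad_exists:
  assumes val: "valuation \<sigma>" and no: "\<not> has_nowhere_zero_flow 5 G"
  shows "\<exists>X. bad \<sigma> X"
proof -
  have "\<exists>X\<subseteq>V. \<not> 5 * sum \<sigma> X \<le> 3 * int (d X)"
    using flow_of_balanced_valuation[OF G(1,2) _ sum_valuation_verts[OF val]] val no
    unfolding valuation_def by blast
  then obtain X where X: "X \<subseteq> V" "5 * sum \<sigma> X > 3 * int (d X)" by force
  then have "0 < sum \<sigma> X" by linarith
  then show ?thesis using unbalanced_bad[OF val X(1)] X(2) by auto
qed

lemma bad_ends:
  assumes "bad \<sigma> X" "e \<in> E2" "ends G e = {u, v}" "\<sigma> v = - 1"
  shows "u \<in> X" "v \<notin> X"
proof -
  have "v \<in> X \<Longrightarrow> \<sigma> v = 1" using assms(1-3) unfolding bad_def by blast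
  then show "v \<notin> X" using assms(4) by auto
  moreover have "{u, v} \<inter> X \<noteq> {}" using assms(1-3) unfolding bad_def boundary_def by blast
  ultimately show "u \<in> X" by blast
qed

section \<open>Uncrossing of 6-edge cuts\<close>

definition six_cut :: "'v set \<Rightarrow> bool" where
  "six_cut S \<longleftrightarrow> S \<subseteq> V \<and> d S = 6 \<and> boundary G E0 S = {}"

lemma six_cut_bad: "bad \<sigma> X \<Longrightarrow> six_cut X"
  by (simp add: bad_def six_cut_def)

text \<open>Complementation negates the sum in \<open>bad\<close> but preserves the cut; hence
  uncrossing is carried out for \<open>six_cut\<close>.\<close>

lemma six_cut_compl: "six_cut X \<Longrightarrow> six_cut (V - X)"
  using boundary_Diff_verts[OF G(1)] M_subset(3) by (auto simp: six_cut_def)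

text \<open>The four corners of two crossing cuts each contain exactly one end of an edge of \<open>E2\<close>, hence have at
  least 3 vertices and boundary at least 5, while opposite corners have total boundary at most 10.\<close>

lemma corner_small:
  assumes S: "six_cut S" and R: "six_cut R" and E2: "E2 = {a, b}"
    and a: "ends G a = {u1, v1}" "u1 \<in> S \<inter> R" "v1 \<in> V - (S \<union> R)"
    and b: "ends G b = {u2, v2}" "u2 \<in> S - R" "v2 \<in> R - S"
  shows "card (S \<inter> R) \<le> 3"
proof -
  have V: "S \<subseteq> V" "R \<subseteq> V" and d: "d S = 6" "d R = 6"
    and c: "boundary G E0 S = {}" "boundary G E0 R = {}"
    using S R by (auto simp: six_cut_def)
  let ?C = "S \<inter> R" and ?D = "S \<union> R"
  have VC: "?C \<subseteq> V" "?D \<subseteq> V" using V by auto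
  have cC: "boundary G E0 ?C = {}" "boundary G E0 ?D = {}" using c unfolding boundary_def by blast+
  have "boundary G E2 ?C = {a}" "boundary G E2 ?D = {a}"
    using a b unfolding E2 boundary_def by auto
  then have e: "card (boundary G E2 ?C) = 1" "card (boundary G E2 (V - ?D)) = 1"
    using boundary_Diff_verts[OF G(1) M_subset(4) VC(2)] by auto
  have C3: "3 \<le> card ?C" using card_closed_ge_3[OF VC(1) cC(1) e(1)] .
  have D3: "3 \<le> card (V - ?D)"
    using card_closed_ge_3[OF _ _ e(2)] cC(2) boundary_Diff_verts[OF G(1) M_subset(3) VC(2)] by auto
  have fin: "finite S" "finite R" using V finV finite_subset by auto
  have ne: "?C \<noteq> {}" "V - ?C \<noteq> {}" "?D \<noteq> {}" "V - ?D \<noteq> {}" using a by auto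
  have "card ?C \<le> card ?D" using fin by (intro card_mono) auto
  \<comment> \<open>Both \<open>S \<union> R\<close> and its complement have at least 3 vertices, so
    \<open>small_cut\<close> excludes fewer than 5 edges.\<close>
  then have dD: "5 \<le> d ?D"
    using small_cut[OF G VC(2) ne(3,4)] C3 D3 by linarith
  have "b \<in> edges G" using E2 M_subset(4) by auto
  then have "d ?C + d ?D + 2 \<le> d S + d R"
    using boundary_uncross[OF G(1) order.refl _ b] by blast
  then have dC: "d ?C \<le> 5" using dD d by linarith
  \<comment> \<open>The complement of the corner contains \<open>u2\<close> besides the opposite
    corner. With at least 4 vertices it is too large for a cut of at most 5 edges, so the corner
    itself is the small side.\<close>
  have "insert u2 (V - ?D) \<subseteq> V - ?C" using b V by auto
  then have "card (insert u2 (V - ?D)) \<le> card (V - ?C)" using finV by (intro card_mono) auto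
  moreover have "card (insert u2 (V - ?D)) = Suc (card (V - ?D))" using finV b by (intro card_insert_disjoint) auto
  ultimately have "4 \<le> card (V - ?C)" using D3 by linarith
  then show ?thesis using small_cut[OF G VC(1) ne(1,2)] dC by linarith
qed

text \<open>The triple intersection still contains one end of \<open>a\<close> and none of
  \<open>b\<close>, so it has at least 3 vertices. It lies in two corners with at most 3 vertices
  and equals both.\<close>

lemma corner_eq:
  assumes S: "six_cut S" and S': "six_cut S'" and R: "six_cut R" and E2: "E2 = {a, b}"
    and a: "ends G a = {u1, v1}" "u1 \<in> S \<inter> S' \<inter> R" "v1 \<in> V - (S \<union> S' \<union> R)"
    and b: "ends G b = {u2, v2}" "u2 \<in> S \<inter> S' - R" "v2 \<in> R - (S \<union> S')"
  shows "S \<inter> R = S' \<inter> R"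
proof -
  let ?Y = "S \<inter> S' \<inter> R"
  have V: "S \<subseteq> V" "S' \<subseteq> V" "R \<subseteq> V"
    and c: "boundary G E0 S = {}" "boundary G E0 S' = {}" "boundary G E0 R = {}"
    using S S' R by (auto simp: six_cut_def)
  have cY: "boundary G E0 ?Y = {}" using c unfolding boundary_def by blast
  have "boundary G E2 ?Y = {a}" using a b unfolding E2 boundary_def by auto
  then have Y: "3 \<le> card ?Y" using card_closed_ge_3[of ?Y] V cY by auto
  have fin: "finite (S \<inter> R)" "finite (S' \<inter> R)" using V finV finite_subset by blast+
  have "card (S \<inter> R) \<le> 3" using a b by (intro corner_small[OF S R E2, of u1 v1 u2 v2]) auto
  then have "?Y = S \<inter> R" using Y by (intro card_seteq[OF fin(1)]) auto
  moreover have "card (S' \<inter> R) \<le> 3" using a b by (intro corner_small[OF S' R E2, of u1 v1 u2 v2]) auto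
  then have "?Y = S' \<inter> R" using Y by (intro card_seteq[OF fin(2)]) auto
  ultimately show ?thesis by simp
qed

theorem nowhere_zero_5_flow: "has_nowhere_zero_flow 5 G"
proof (rule ccontr)
  assume no: "\<not> ?thesis"
  obtain \<sigma> where val: "valuation \<sigma>" using valuation_exists ..
  obtain X where X: "bad \<sigma> X" using bad_exists[OF val no] ..
  then have "card E2 = 2" by (simp add: bad_def)
  then obtain a b where E2: "E2 = {a, b}" "a \<noteq> b" by (auto simp: card_2_iff)
  have ends: "\<exists>u v. u \<in> V \<and> v \<in> V \<and> ends G e = {u, v} \<and> \<sigma> u = 1 \<and> \<sigma> v = - 1" if e: "e \<in> E2" for e
  proof -
    have eM: "e \<in> M1" using e by (simp add: E2_def)
    obtain x y where xy: "x \<in> V" "y \<in> V" "x \<noteq> y" "ends G e = {x, y}"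
      by (rule one_factor_endsE[OF G(1) M1 eM])
    have "\<sigma> x + \<sigma> y = 0" using val eM xy by (auto simp: valuation_def alternating_def)
    moreover have "\<sigma> x = 1 \<or> \<sigma> x = - 1" using val xy by (auto simp: valuation_def)
    ultimately have "\<sigma> x = 1 \<and> \<sigma> y = - 1 \<or> \<sigma> y = 1 \<and> \<sigma> x = - 1" by auto
    then show ?thesis using xy by (metis insert_commute)
  qed
  obtain u1 v1 where a: "u1 \<in> V" "v1 \<in> V" "ends G a = {u1, v1}" "\<sigma> u1 = 1" "\<sigma> v1 = - 1"
    using ends[of a] E2 by blast
  obtain u2 v2 where b: "u2 \<in> V" "v2 \<in> V" "ends G b = {u2, v2}" "\<sigma> u2 = 1" "\<sigma> v2 = - 1"
    using ends[of b] E2 by blast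
  have inE2: "a \<in> E2" "b \<in> E2" using E2 by auto
  have "ends G a \<inter> ends G b = {}"
    using one_factor_disjoint_ends[OF G(1) M1, of a b] inE2 E2(2) by (simp add: E2_def)
  then have disj: "u1 \<noteq> u2" "u1 \<noteq> v2" "v1 \<noteq> u2" "v1 \<noteq> v2" using a b by auto
  have neq: "u1 \<noteq> v1" "u2 \<noteq> v2" using a b by auto
  \<comment> \<open>Compared with \<open>X\<close>, the bad set \<open>R\<close> for \<sigma>2
    contains the same end of \<open>a\<close> and the other end of \<open>b\<close>, and the bad set
    \<open>Z\<close> for \<sigma>3 contains the other end of both.\<close>
  define \<sigma>2 where "\<sigma>2 = (\<lambda>v. if v \<in> ends G b then - \<sigma> v else \<sigma> v)"
  define \<sigma>3 where "\<sigma>3 = (\<lambda>v. if v \<in> ends G a then - \<sigma>2 v else \<sigma>2 v)"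
  have val2: "valuation \<sigma>2" unfolding \<sigma>2_def by (rule valuation_flip[OF val inE2(2)])
  have val3: "valuation \<sigma>3" unfolding \<sigma>3_def by (rule valuation_flip[OF val2 inE2(1)])
  obtain R where R: "bad \<sigma>2 R" using bad_exists[OF val2 no] ..
  obtain Z where Z: "bad \<sigma>3 Z" using bad_exists[OF val3 no] ..
  have a': "ends G a = {v1, u1}" and b': "ends G b = {v2, u2}" using a b by auto
  have X_in: "u1 \<in> X" "v1 \<notin> X" "u2 \<in> X" "v2 \<notin> X"
    using bad_ends[OF X inE2(1) a(3)] bad_ends[OF X inE2(2) b(3)] a b by auto
  have "\<sigma>2 v1 = - 1" "\<sigma>2 u2 = - 1" using a b disj by (auto simp: \<sigma>2_def)
  then have R_in: "u1 \<in> R" "v1 \<notin> R" "v2 \<in> R" "u2 \<notin> R"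
    using bad_ends[OF R inE2(1) a(3)] bad_ends[OF R inE2(2) b'] by auto
  have "\<sigma>3 u1 = - 1" "\<sigma>3 u2 = - 1" using a b disj by (auto simp: \<sigma>3_def \<sigma>2_def)
  then have Z_in: "v1 \<in> Z" "u1 \<notin> Z" "v2 \<in> Z" "u2 \<notin> Z"
    using bad_ends[OF Z inE2(1) a'] bad_ends[OF Z inE2(2) b'] by auto
  have cuts: "six_cut X" "six_cut R" "six_cut (V - R)" "six_cut (V - Z)"
    using six_cut_bad six_cut_compl X R Z by auto
  \<comment> \<open>\<open>X\<close> and \<open>V - Z\<close> contain the same ends of common edges.
    They are compared inside \<open>R\<close> and then inside its complement, where \<open>a\<close>
    and \<open>b\<close> change roles.\<close>
  have "X \<inter> R = (V - Z) \<inter> R"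
    using X_in R_in Z_in a b by (intro corner_eq[OF cuts(1,4,2) E2(1) a(3) _ _ b(3)]) auto
  moreover have "X \<inter> (V - R) = (V - Z) \<inter> (V - R)"
    using X_in R_in Z_in a b E2(1)
    by (intro corner_eq[OF cuts(1,4,3) _ b(3) _ _ a(3)]) auto
  ultimately have eq: "X = V - Z" using X by (auto simp: bad_def)
  have ZV: "Z \<subseteq> V" using Z by (simp add: bad_def)
  then have finZ: "finite Z" using finV finite_subset by blast
  have "Z = V - X" using eq ZV by auto
  then have "sum \<sigma> Z = - 4" using sum_valuation_compl[OF val, of X] X by (simp add: bad_def)
  \<comment> \<open>Among the recoloured vertices exactly \<open>v1\<close> and \<open>v2\<close>
    lie in \<open>Z\<close>, and both change from -1 to 1. The new sum is -4 + 4 = 0, whereas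
    \<open>bad\<close> demands 4.\<close>
  moreover have "sum \<sigma>3 Z = sum \<sigma> Z + (\<Sum>v\<in>Z. if v \<in> {v1, v2} then 2 else 0)"
    unfolding sum.distrib[symmetric]
    using a b disj Z_in by (intro sum.cong refl) (auto simp: \<sigma>3_def \<sigma>2_def)
  moreover have "(\<Sum>v\<in>Z. if v \<in> {v1, v2} then 2 else (0::int)) = (\<Sum>v\<in>{v1, v2}. 2)"
    using finZ Z_in by (subst sum.inter_restrict[symmetric]) (auto intro!: sum.cong)
  moreover have "(\<Sum>v\<in>{v1, v2}. 2) = (4::int)" using disj by simp
  ultimately show False using Z by (simp add: bad_def)
qed

end

theorem theorem1p2:
  fixes G :: "('v, 'e) mgraph"
  assumes "multigraph G"
    and "cubic G"
    and "cyclically_edge_connected 6 G"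
    and "mu2 G \<le> 2"
  shows "has_nowhere_zero_flow 5 G"
proof -
  define A where "A = {enat (card (M1 \<inter> M2)) | M1 M2. one_factor G M1 \<and> one_factor G M2}"
  have mu2: "mu2 G = Inf A" by (simp add: mu2_def A_def)
  \<comment> \<open>The infimum of the empty set is \<infinity>, so the bound on
    \<open>mu2 G\<close> provides 1-factors; the infimum of a nonempty set is its least element and
    is attained.\<close>
  then have "A \<noteq> {}" using assms(4) by (auto simp: Inf_enat_def)
  then obtain x where x: "x \<in> A" by blast
  then have "(LEAST x. x \<in> A) \<in> A" by (rule LeastI)
  then have "mu2 G \<in> A" using x unfolding mu2 Inf_enat_def by auto
  then obtain M1 M2 where M: "one_factor G M1" "one_factor G M2" "mu2 G = enat (card (M1 \<inter> M2))"
    unfolding A_def by blast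
  have "card (M1 \<inter> M2) \<le> 2" using assms(4) M(3) by (simp add: numeral_eq_enat)
  then interpret cubic_two_one_factors G M1 M2
    using assms M by unfold_locales
  show ?thesis by (rule nowhere_zero_5_flow)
qed

end
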